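(* Let $1<p<\infty$, let $A\in\mathbb{R}^{n\times n}$ be an invertible matrix such that $A^k=I$ for some $k\in\mathbb{N}$, and let $w$ be a weight. Then $w\in\mathcal{A}_{A,p}$ if and only if $M_{A^{-1}}$ is bounded on $L^p(w)$, i.e. if and only if there is a constant $C$ such that $\int_{\mathbb{R}^n} (M_{A^{-1}}f)^p\, w\,dx\le C\int_{\mathbb{R}^n}|f|^p\, w\,dx$ for all $f\in L^p(w)$.
   Context: A weight is a locally integrable function $w$ on $\mathbb{R}^n$ with $0<w<\infty$ a.e. Cubes $Q$ have sides parallel to the axes. For an invertible matrix $A$, $w_A(x)=w(Ax)$ and $M_{A^{-1}}f(x)=Mf(A^{-1}x)=\sup_{Q\ni A^{-1}x}\frac1{|Q|}\int_Q|f(y)|\,dy$. For $1<p<\infty$, $w\in\mathcal{A}_{A,p}$ if $[w]_{\mathcal{A}_{A,p}}=\sup_Q \frac1{|Q|}\int_Q w_A(x)\,dx\left(\frac1{|Q|}\int_Q w(x)^{-\frac1{p-1}}\,dx\right)^{p-1}<\infty$. *)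

theory Defs
  imports "HOL-Analysis.Analysis"
begin

text \<open>
  Everything is modulo Lebesgue null sets, so a weight (which is finite almost everywhere) is
  represented by a real-valued function; the values on the null set where it is not positive are
  irrelevant.
\<close>

definition weight :: "(real ^ 'n \<Rightarrow> real) \<Rightarrow> bool" where
  "weight w \<longleftrightarrow>
     (\<forall>K. compact K \<longrightarrow> w absolutely_integrable_on K) \<and> (AE x in lebesgue. 0 < w x)"

definition cubes :: "(real ^ 'n) set set" where
  "cubes = {cbox a (a + (\<chi> i. l)) | a l. 0 < l}"

definition average :: "(real ^ 'n) set \<Rightarrow> (real ^ 'n \<Rightarrow> ennreal) \<Rightarrow> ennreal" where
  "average Q g = (\<integral>\<^sup>+x\<in>Q. g x \<partial>lebesgue) / emeasure lebesgue Q"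

text \<open>
  Real powers on \<open>[0, \<infinity>]\<close>. Only positive exponents occur below, so the value at infinity is
  infinity.
\<close>

definition epowr :: "ennreal \<Rightarrow> real \<Rightarrow> ennreal" where
  "epowr x r = (if x = \<infinity> then \<infinity> else ennreal (enn2real x powr r))"

definition maximal_function :: "(real ^ 'n \<Rightarrow> real) \<Rightarrow> real ^ 'n \<Rightarrow> ennreal" where
  "maximal_function f x = (SUP Q \<in> {Q \<in> cubes. x \<in> Q}. average Q (\<lambda>y. ennreal \<bar>f y\<bar>))"

definition maximal_function_inv ::
    "real ^ 'n ^ 'n \<Rightarrow> (real ^ 'n \<Rightarrow> real) \<Rightarrow> real ^ 'n \<Rightarrow> ennreal" where
  "maximal_function_inv A f x = maximal_function f (matrix_inv A *v x)"

definition A_constant :: "real ^ 'n ^ 'n \<Rightarrow> real \<Rightarrow> (real ^ 'n \<Rightarrow> real) \<Rightarrow> ennreal" where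
  "A_constant A p w =
     (SUP Q \<in> cubes. average Q (\<lambda>x. ennreal (w (A *v x))) *
        epowr (average Q (\<lambda>x. ennreal (w x powr (- 1 / (p - 1))))) (p - 1))"

definition A_class :: "real ^ 'n ^ 'n \<Rightarrow> real \<Rightarrow> (real ^ 'n \<Rightarrow> real) set" where
  "A_class A p = {w. weight w \<and> A_constant A p w < \<infinity>}"

definition weighted_Lp :: "real \<Rightarrow> (real ^ 'n \<Rightarrow> real) \<Rightarrow> (real ^ 'n \<Rightarrow> real) set" where
  "weighted_Lp p w = {f. f \<in> borel_measurable lebesgue \<and>
     (\<integral>\<^sup>+x. ennreal (\<bar>f x\<bar> powr p) * ennreal (w x) \<partial>lebesgue) < \<infinity>}"

text \<open>The power operation of the type class on \<open>real ^ 'n ^ 'n\<close> is componentwise.\<close>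

primrec matrix_pow :: "real ^ 'n ^ 'n \<Rightarrow> nat \<Rightarrow> real ^ 'n ^ 'n" where
  "matrix_pow A 0 = mat 1"
| "matrix_pow A (Suc k) = A ** matrix_pow A k"

end

theory Submission
  imports Defs
begin

text \<open>
  Put \<open>v = w \<circ> A\<close> and \<open>s = w powr (- 1 / (p - 1))\<close>. Testing the maximal function on
  \<open>(\<bar>w\<bar> + \<epsilon>) powr (- 1 / (p - 1))\<close> restricted to a cube and letting \<open>\<epsilon>\<close> tend to \<open>0\<close> gives the
  class condition.

  Conversely, Jensen's inequality turns the class condition into \<open>\<integral>\<^bsub>Q\<^esub> v \<le> K \<integral>\<^bsub>Q\<^esub> w\<close> for all
  cubes, hence \<open>w \<circ> A \<le> K w\<close> almost everywhere; running through the finite orbit of \<open>A\<close> gives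
  \<open>w \<le> c (w \<circ> A)\<close>. The pair \<open>(v, s)\<close> then satisfies a two-weight Muckenhoupt condition together
  with \<open>v powr (- 1 / (p - 1)) \<le> L s\<close>, and Lerner's argument bounds
  \<open>(M f) powr (p - 1)\<close> pointwise by \<open>N\<^sub>v ((N\<^sub>s (\<bar>f\<bar> / s)) powr (p - 1) / v)\<close>. Here \<open>N\<^sub>\<mu> g\<close> is the supremum
  over cubes \<open>Q\<close> of \<open>(\<integral>\<^bsub>Q\<^esub> g d\<mu>) / \<mu> (3 Q)\<close>, which by the Vitali covering lemma is of strong
  type for every locally finite \<open>\<mu>\<close>, doubling or not. A linear change of variables finishes the proof.
\<close>

section \<open>Powers on the extended half-line and the layer-cake formula\<close>

lemma epowr_top [simp]: "epowr top r = top"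
  by (simp add: epowr_def)

lemma epowr_0 [simp]: "epowr 0 r = 0"
  by (simp add: epowr_def)

lemma epowr_ennreal [simp]: "0 \<le> x \<Longrightarrow> epowr (ennreal x) r = ennreal (x powr r)"
  by (simp add: epowr_def)

lemma epowr_eq_top_iff: "epowr x r = \<infinity> \<longleftrightarrow> x = \<infinity>"
  by (simp add: epowr_def)

lemma epowr_1 [simp]: "epowr x 1 = x"
  by (cases x) (simp_all add: epowr_def)

lemma epowr_mono:
  assumes "x \<le> y" "0 \<le> r"
  shows "epowr x r \<le> epowr y r"
  using assms
  by (cases x; cases y) (auto simp: epowr_def top_unique intro!: ennreal_leI powr_mono2)

text \<open>\<open>epowr\<close> fixes 0 and infinity for every exponent, so a factor of either kind
  behaves alike on both sides and the sign of \<open>r\<close> does not matter.\<close>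

lemma epowr_mult:
  shows "epowr (x * y) r = epowr x r * epowr y r"
proof (cases "x = 0 \<or> y = 0 \<or> x = \<infinity> \<or> y = \<infinity>")
  case True
  then show ?thesis
    by (auto simp: epowr_def ennreal_mult_eq_top_iff ennreal_mult_top ennreal_top_mult enn2real_eq_0_iff)
next
  case False
  then obtain a b where "x = ennreal a" "y = ennreal b" "a \<ge> 0" "b \<ge> 0"
    by (cases x; cases y) auto
  then show ?thesis
    by (simp add: ennreal_mult[symmetric] powr_mult)
qed

lemma epowr_epowr: "epowr (epowr x r) s = epowr x (r * s)"
  by (cases x) (auto simp: powr_powr)

lemma epowr_add: "epowr x (r + s) = epowr x r * epowr x s"
  by (cases x) (auto simp: powr_add ennreal_mult)

text \<open>\<open>epowr _ r\<close> and \<open>epowr _ (1 / r)\<close> are monotone and inverse to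
  each other, also at 0 and infinity.\<close>

lemma epowr_le_iff:
  assumes "0 < r"
  shows "epowr x r \<le> y \<longleftrightarrow> x \<le> epowr y (1 / r)"
proof
  assume "epowr x r \<le> y"
  from epowr_mono[OF this, of "1 / r"] show "x \<le> epowr y (1 / r)"
    using assms by (simp add: epowr_epowr)
next
  assume "x \<le> epowr y (1 / r)"
  from epowr_mono[OF this, of r] show "epowr x r \<le> y"
    using assms by (simp add: epowr_epowr)
qed

lemma borel_measurable_epowr [measurable]:
  assumes [measurable]: "f \<in> borel_measurable M"
  shows "(\<lambda>x. epowr (f x) r) \<in> borel_measurable M"
  unfolding epowr_def by measurable

text \<open>The density \<open>r * t powr (r - 1)\<close> has the antiderivative
  \<open>t powr r\<close>, which settles finite \<open>x\<close>; the integral for infinite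
  \<open>x\<close> dominates all finite ones.\<close>

lemma layer_cake_epowr:
  fixes x :: ennreal
  assumes r: "0 < r"
  shows "(\<integral>\<^sup>+t. ennreal (r * t powr (r - 1)) * indicator {t. 0 < t \<and> ennreal t < x} t \<partial>lborel) = epowr x r"
proof -
  define \<phi> where "\<phi> t = r * t powr (r - 1)" for t
  have fin: "(\<integral>\<^sup>+t. ennreal (\<phi> t) * indicator {t. 0 < t \<and> ennreal t < ennreal c} t \<partial>lborel) = ennreal (c powr r)"
    if "0 \<le> c" for c
  proof -
    have "((\<lambda>t. r * t powr (r - 1)) has_integral r * (c powr (r - 1 + 1) / (r - 1 + 1))) {0..c}"
      using r that by (intro has_integral_mult_right has_integral_powr_from_0) auto
    then have "(\<phi> has_integral c powr r) {0..c}"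
      using r unfolding \<phi>_def by simp
    then have "(\<integral>\<^sup>+t. indicator {0..c} t * \<phi> t \<partial>lborel) = ennreal (c powr r)"
      by (rule nn_integral_has_integral_lebesgue[rotated]) (use r in \<open>auto simp: \<phi>_def\<close>)
    moreover have "(\<integral>\<^sup>+t. ennreal (indicator {0..c} t * \<phi> t) \<partial>lborel) =
       (\<integral>\<^sup>+t. ennreal (\<phi> t) * indicator {t. 0 < t \<and> ennreal t < ennreal c} t \<partial>lborel)"
    proof (intro nn_integral_cong_AE)
      \<comment> \<open>The closed interval and the range given by strict inequalities differ only
        at their endpoints.\<close>
      have "AE t in lborel. t \<noteq> 0 \<and> t \<noteq> c"
        using AE_lborel_singleton[of 0] AE_lborel_singleton[of c] by eventually_elim auto
      then show "AE t in lborel. ennreal (indicator {0..c} t * \<phi> t) =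
          ennreal (\<phi> t) * indicator {t. 0 < t \<and> ennreal t < ennreal c} t"
        by eventually_elim (auto simp: indicator_def ennreal_less_iff)
    qed
    ultimately show ?thesis by simp
  qed
  show ?thesis
  proof (cases x)
    case (real c)
    then show ?thesis using fin[of c] by (simp add: \<phi>_def)
  next
    case top
    have "ennreal (real n) \<le> (\<integral>\<^sup>+t. ennreal (\<phi> t) * indicator {t. 0 < t \<and> ennreal t < x} t \<partial>lborel)" for n
    proof -
      \<comment> \<open>Chosen so that the integral truncated at \<open>c\<close> equals
        \<open>n\<close>.\<close>
      define c where "c = real n powr (1 / r)"
      have "ennreal (real n) = ennreal (c powr r)"
        using r by (cases n) (auto simp: c_def powr_powr)
      also have "\<dots> = (\<integral>\<^sup>+t. ennreal (\<phi> t) * indicator {t. 0 < t \<and> ennreal t < ennreal c} t \<partial>lborel)"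
        by (rule fin[symmetric]) (simp add: c_def)
      also have "\<dots> \<le> (\<integral>\<^sup>+t. ennreal (\<phi> t) * indicator {t. 0 < t \<and> ennreal t < x} t \<partial>lborel)"
        using top by (intro nn_integral_mono mult_left_mono) (auto simp: indicator_def)
      finally show ?thesis .
    qed
    then have "(\<integral>\<^sup>+t. ennreal (\<phi> t) * indicator {t. 0 < t \<and> ennreal t < x} t \<partial>lborel) = \<infinity>"
      by (metis ennreal_of_nat_eq_real_of_nat ennreal_Ex_less_of_nat infinity_ennreal_def leD less_top)
    then show ?thesis using top by (simp add: \<phi>_def)
  qed
qed

text \<open>The Marcinkiewicz argument: integrate the weak bound against a power of the height
  \<open>t\<close> and exchange the integrals. At height \<open>t\<close> the bound sees
  \<open>g\<close> only where \<open>t < 2 * g\<close>, so the inner integral stops at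
  \<open>2 * g x\<close> and leaves \<open>g x * (2 * g x) powr (r - 1)\<close>; it converges at 0
  because \<open>1 < r\<close>.\<close>

lemma weak_type_imp_strong_type:
  fixes g N :: "'a \<Rightarrow> ennreal"
  assumes "sigma_finite_measure M"
    and [measurable]: "g \<in> borel_measurable M" "N \<in> borel_measurable M"
    and r: "1 < r"
    and weak: "\<And>t. 0 < t \<Longrightarrow> ennreal t * emeasure M {x \<in> space M. ennreal t < N x}
      \<le> 2 * (\<integral>\<^sup>+x. g x * indicator {x. ennreal t < 2 * g x} x \<partial>M)"
  shows "(\<integral>\<^sup>+x. epowr (N x) r \<partial>M) \<le> ennreal (r / (r - 1) * 2 powr r) * (\<integral>\<^sup>+x. epowr (g x) r \<partial>M)"
proof -
  interpret sigma_finite_measure M by fact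
  interpret pair_sigma_finite lborel M ..
  \<comment> \<open>\<open>\<phi>\<close> and \<open>\<psi>\<close> are the layer-cake densities for
    the exponents \<open>r\<close> and \<open>r - 1\<close>. Writing
    \<open>\<phi> t = c * \<psi> t * t\<close> splits off the factor \<open>t\<close> that the weak
    bound consumes.\<close>
  define \<phi> where "\<phi> t = r * t powr (r - 1)" for t
  define \<psi> where "\<psi> t = (r - 1) * t powr (r - 1 - 1)" for t
  define c where "c = r / (r - 1)"
  have c: "0 < c" using r by (simp add: c_def)
  have \<phi>\<psi>: "\<phi> t = c * \<psi> t * t" if "0 < t" for t
    using r that by (simp add: \<phi>_def \<psi>_def c_def powr_diff power2_eq_square)
  have [measurable]: "\<phi> \<in> borel_measurable borel" "\<psi> \<in> borel_measurable borel"
    unfolding \<phi>_def \<psi>_def by measurable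
  have nonneg: "0 \<le> \<psi> t" "0 \<le> \<phi> t" for t
    using r by (auto simp: \<phi>_def \<psi>_def)
  have "(\<integral>\<^sup>+x. epowr (N x) r \<partial>M)
      = (\<integral>\<^sup>+x. (\<integral>\<^sup>+t. ennreal (\<phi> t) * indicator {t. 0 < t \<and> ennreal t < N x} t \<partial>lborel) \<partial>M)"
    using r layer_cake_epowr[of r] unfolding \<phi>_def by simp
  also have "\<dots> = (\<integral>\<^sup>+t. (\<integral>\<^sup>+x. ennreal (\<phi> t) * indicator {t. 0 < t \<and> ennreal t < N x} t \<partial>M) \<partial>lborel)"
    by (rule Fubini') measurable
  also have "\<dots> \<le> (\<integral>\<^sup>+t. (\<integral>\<^sup>+x. ennreal (2 * c) * (g x * (ennreal (\<psi> t) * indicator {t. 0 < t \<and> ennreal t < 2 * g x} t)) \<partial>M) \<partial>lborel)"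
  proof (rule nn_integral_mono)
    fix t :: real
    show "(\<integral>\<^sup>+x. ennreal (\<phi> t) * indicator {t. 0 < t \<and> ennreal t < N x} t \<partial>M)
      \<le> (\<integral>\<^sup>+x. ennreal (2 * c) * (g x * (ennreal (\<psi> t) * indicator {t. 0 < t \<and> ennreal t < 2 * g x} t)) \<partial>M)"
    proof (cases "0 < t")
      case True
      have "(\<integral>\<^sup>+x. ennreal (\<phi> t) * indicator {t. 0 < t \<and> ennreal t < N x} t \<partial>M)
          = (\<integral>\<^sup>+x. ennreal (\<phi> t) * indicator {x \<in> space M. ennreal t < N x} x \<partial>M)"
        using True by (intro nn_integral_cong) (auto simp: indicator_def)
      also have "\<dots> = ennreal (\<phi> t) * emeasure M {x \<in> space M. ennreal t < N x}"
        by (rule nn_integral_cmult_indicator) measurable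
      also have "\<dots> = ennreal (c * \<psi> t) * (ennreal t * emeasure M {x \<in> space M. ennreal t < N x})"
        using True c nonneg by (simp add: \<phi>\<psi> ennreal_mult mult.assoc)
      also have "\<dots> \<le> ennreal (c * \<psi> t) * (2 * (\<integral>\<^sup>+x. g x * indicator {x. ennreal t < 2 * g x} x \<partial>M))"
        using weak[OF True] by (intro mult_left_mono) auto
      also have "\<dots> = (\<integral>\<^sup>+x. ennreal (c * \<psi> t) * (2 * (g x * indicator {x. ennreal t < 2 * g x} x)) \<partial>M)"
        by (simp add: nn_integral_cmult)
      also have "\<dots> = (\<integral>\<^sup>+x. ennreal (2 * c) * (g x * (ennreal (\<psi> t) * indicator {t. 0 < t \<and> ennreal t < 2 * g x} t)) \<partial>M)"
        using True c nonneg
        by (intro nn_integral_cong) (auto simp: indicator_def ennreal_mult mult_ac)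
      finally show ?thesis .
    qed (simp add: indicator_def)
  qed
  also have "\<dots> = (\<integral>\<^sup>+x. (\<integral>\<^sup>+t. ennreal (2 * c) * (g x * (ennreal (\<psi> t) * indicator {t. 0 < t \<and> ennreal t < 2 * g x} t)) \<partial>lborel) \<partial>M)"
    by (rule Fubini'[symmetric]) measurable
  also have "\<dots> = (\<integral>\<^sup>+x. ennreal (2 * c) * (g x * epowr (2 * g x) (r - 1)) \<partial>M)"
    using r layer_cake_epowr[of "r - 1", folded \<psi>_def]
    by (simp add: nn_integral_cmult)
  also have "\<dots> = (\<integral>\<^sup>+x. ennreal (c * 2 powr r) * epowr (g x) r \<partial>M)"
  proof (intro nn_integral_cong)
    fix x
    have "g x * epowr (2 * g x) (r - 1) = epowr 2 (r - 1) * (epowr (g x) 1 * epowr (g x) (r - 1))"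
      by (simp add: epowr_mult mult_ac)
    also have "epowr (g x) 1 * epowr (g x) (r - 1) = epowr (g x) r"
      by (subst epowr_add[symmetric]) simp
    also have "epowr 2 (r - 1) = ennreal (2 powr (r - 1))"
      using epowr_ennreal[of 2 "r - 1"] by simp
    finally have "g x * epowr (2 * g x) (r - 1) = ennreal (2 powr (r - 1)) * epowr (g x) r" .
    moreover have "ennreal (2 * c) * ennreal (2 powr (r - 1)) = ennreal (c * 2 powr r)"
      using c by (simp add: ennreal_mult[symmetric] powr_diff)
    ultimately show "ennreal (2 * c) * (g x * epowr (2 * g x) (r - 1)) = ennreal (c * 2 powr r) * epowr (g x) r"
      by (simp add: mult.assoc[symmetric])
  qed
  also have "\<dots> = ennreal (c * 2 powr r) * (\<integral>\<^sup>+x. epowr (g x) r \<partial>M)"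
    by (rule nn_integral_cmult) measurable
  finally show ?thesis by (simp add: c_def)
qed

section \<open>Maximal operators of a locally finite measure\<close>

definition cube :: "real ^ 'n \<Rightarrow> real \<Rightarrow> (real ^ 'n) set" where
  "cube a l = cbox a (a + (\<chi> i. l))"

definition tripled :: "real ^ 'n \<Rightarrow> real \<Rightarrow> (real ^ 'n) set" where
  "tripled a l = cube (a - (\<chi> i. l)) (3 * l)"

lemma cubes_eq: "cubes = {cube a l | a l. 0 < l}"
  by (simp add: cubes_def cube_def)

lemma mem_cube: "x \<in> cube a l \<longleftrightarrow> (\<forall>i. a $ i \<le> x $ i \<and> x $ i \<le> a $ i + l)"
  by (simp add: cube_def mem_box_cart)

lemma mem_tripled: "x \<in> tripled a l \<longleftrightarrow> (\<forall>i. a $ i - l \<le> x $ i \<and> x $ i \<le> a $ i + 2 * l)"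
  by (simp add: tripled_def mem_cube algebra_simps)

lemma cube_subset_tripled: "0 \<le> l \<Longrightarrow> cube a l \<subseteq> tripled a l"
  by (auto simp: mem_cube mem_tripled) (smt (verit))+

lemma sets_cube [measurable, simp]: "cube a l \<in> sets lebesgue" "tripled a l \<in> sets lebesgue"
  by (simp_all add: cube_def tripled_def)

lemma tripled_in_cubes: "0 < l \<Longrightarrow> tripled a l \<in> cubes"
  by (auto simp: cubes_eq tripled_def intro!: exI[of _ "3 * l"])

lemma cube_in_cubes: "0 < l \<Longrightarrow> cube a l \<in> cubes"
  by (auto simp: cubes_eq)

lemma emeasure_cube:
  fixes a :: "real ^ 'n"
  assumes "0 \<le> l"
  shows "emeasure lebesgue (cube a l) = ennreal (l ^ CARD('n))"
proof -
  have ne: "cbox a (a + (\<chi> i. l)) \<noteq> {}"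
    using assms by (simp add: interval_ne_empty_cart)
  have "emeasure lebesgue (cube a l) = ennreal (measure lborel (cbox a (a + (\<chi> i. l))))"
    using emeasure_lborel_cbox_finite[of a "a + (\<chi> i. l)"]
    by (simp add: cube_def emeasure_eq_ennreal_measure less_top)
  also have "measure lborel (cbox a (a + (\<chi> i. l))) = l ^ CARD('n)"
    by (simp add: content_cbox_cart[OF ne])
  finally show ?thesis .
qed

lemma emeasure_tripled:
  fixes a :: "real ^ 'n"
  assumes "0 \<le> l"
  shows "emeasure lebesgue (tripled a l) = ennreal (3 ^ CARD('n)) * emeasure lebesgue (cube a l)"
  using assms unfolding tripled_def
  by (subst (1 2) emeasure_cube) (simp_all add: power_mult_distrib ennreal_mult)

text \<open>An exhaustion of the space. The extra 1 in the side keeps the cube nondegenerate at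
  \<open>n = 0\<close>, so that facts about cubes of positive side apply to every member.\<close>

definition central_cube :: "nat \<Rightarrow> (real ^ 'n) set" where
  "central_cube n = cube (\<chi> i. - real n) (2 * real n + 1)"

lemma incseq_central_cube: "incseq central_cube"
proof (intro incseq_SucI subsetI)
  fix n and x :: "real ^ 'n"
  assume x: "x \<in> central_cube n"
  show "x \<in> central_cube (Suc n)"
    unfolding central_cube_def mem_cube
  proof
    fix i
    have "- real n \<le> x $ i \<and> x $ i \<le> - real n + (2 * real n + 1)"
      using x by (simp add: central_cube_def mem_cube)
    then show "(\<chi> i. - real (Suc n)) $ i \<le> x $ i \<and> x $ i \<le> (\<chi> i. - real (Suc n)) $ i + (2 * real (Suc n) + 1)"
      by simp
  qed
qed

lemma UN_central_cube: "(\<Union>n. central_cube n :: (real ^ 'n) set) = UNIV"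
proof (rule sym, rule UNIV_eq_I, rule UN_I)
  fix x :: "real ^ 'n"
  show "x \<in> central_cube (nat \<lceil>norm x\<rceil>)"
    unfolding central_cube_def mem_cube
  proof
    fix i
    have "\<bar>x $ i\<bar> \<le> real (nat \<lceil>norm x\<rceil>)"
      using component_le_norm_cart[of x i] by linarith
    then show "(\<chi> i. - real (nat \<lceil>norm x\<rceil>)) $ i \<le> x $ i \<and>
        x $ i \<le> (\<chi> i. - real (nat \<lceil>norm x\<rceil>)) $ i + (2 * real (nat \<lceil>norm x\<rceil>) + 1)"
      by (simp add: abs_le_iff)
  qed
qed simp

section \<open>Vitali covering and weak-type inequalities on cubes\<close>

lemma cube_subset_tripled_of_meets:
  assumes "cube a l \<inter> cube b m \<noteq> {}" "l \<le> m"
  shows "cube a l \<subseteq> tripled b m"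
proof
  fix x assume x: "x \<in> cube a l"
  obtain y where y: "y \<in> cube a l" "y \<in> cube b m" using assms by blast
  show "x \<in> tripled b m"
    unfolding mem_tripled
  proof
    fix i
    have "a $ i \<le> x $ i \<and> x $ i \<le> a $ i + l" "a $ i \<le> y $ i \<and> y $ i \<le> a $ i + l"
      "b $ i \<le> y $ i \<and> y $ i \<le> b $ i + m"
      using x y by (simp_all add: mem_cube)
    then show "b $ i - m \<le> x $ i \<and> x $ i \<le> b $ i + 2 * m" using assms(2) by linarith
  qed
qed

text \<open>Greedy selection: take a cube of largest side, discard every cube that meets it, and
  recurse on the rest. A discarded cube is no larger than the chosen one, hence lies in its
  triple.\<close>

lemma Vitali_covering_finite_cubes:
  fixes F :: "((real ^ 'n) \<times> real) set"
  assumes "finite F" "\<And>a l. (a, l) \<in> F \<Longrightarrow> 0 \<le> l"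
  shows "\<exists>G \<subseteq> F. disjoint_family_on (\<lambda>(a, l). cube a l) G \<and>
    (\<Union>(a, l)\<in>F. cube a l) \<subseteq> (\<Union>(a, l)\<in>G. tripled a l)"
  using assms
proof (induction F rule: finite_psubset_induct)
  case (psubset F)
  show ?case
  proof (cases "F = {}")
    case False
    have "\<exists>q\<in>F. \<forall>q'\<in>F. snd q' \<le> snd q"
      using Max_in[of "snd ` F"] Max_ge[of "snd ` F"] psubset.hyps False by fastforce
    then obtain b m where bm: "(b, m) \<in> F" "\<And>a l. (a, l) \<in> F \<Longrightarrow> l \<le> m"
      by (metis prod.collapse snd_conv)
    have m: "0 \<le> m" using bm(1) psubset.prems by blast
    define F' where "F' = {(a, l) \<in> F. cube a l \<inter> cube b m = {}}"
    \<comment> \<open>The chosen cube is nonempty and so meets itself; therefore it is discarded too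
      and the induction runs on a strictly smaller family.\<close>
    have "b \<in> cube b m" using m by (simp add: mem_cube)
    then have "(b, m) \<notin> F'" by (auto simp: F'_def)
    moreover have "F' \<subseteq> F" by (auto simp: F'_def)
    ultimately have "F' \<subset> F" using bm(1) by blast
    from psubset.IH[OF this] obtain G where G: "G \<subseteq> F'"
      "disjoint_family_on (\<lambda>(a, l). cube a l) G"
      "(\<Union>(a, l)\<in>F'. cube a l) \<subseteq> (\<Union>(a, l)\<in>G. tripled a l)"
      using psubset.prems \<open>F' \<subseteq> F\<close> by (smt (verit) subsetD)
    have bmG: "(b, m) \<notin> G" using G(1) \<open>(b, m) \<notin> F'\<close> by blast
    have "cube a l \<inter> cube b m = {}" if "(a, l) \<in> G" for a l
      using that G(1) by (auto simp: F'_def)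
    then have "disjoint_family_on (\<lambda>(a, l). cube a l) (insert (b, m) G)"
      using G(2) bmG by (subst disjoint_family_on_insert) auto
    moreover have "(\<Union>(a, l)\<in>F. cube a l) \<subseteq> (\<Union>(a, l)\<in>insert (b, m) G. tripled a l)"
    proof (clarify)
      fix x a l assume al: "(a, l) \<in> F" "x \<in> cube a l"
      show "x \<in> (\<Union>(a, l)\<in>insert (b, m) G. tripled a l)"
      proof (cases "(a, l) \<in> F'")
        case True
        then show ?thesis using G(3) al by blast
      next
        case False
        then have "cube a l \<inter> cube b m \<noteq> {}" using al by (auto simp: F'_def)
        from cube_subset_tripled_of_meets[OF this bm(2)[OF al(1)]] al show ?thesis by auto
      qed
    qed
    ultimately show ?thesis using G(1) \<open>F' \<subseteq> F\<close> bm(1) by (intro exI[of _ "insert (b, m) G"]) auto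
  qed (simp add: disjoint_family_on_def)
qed

text \<open>The triples of a disjoint Vitali subfamily cover the union, and the integrals over
  disjoint cubes add up to at most the whole integral. Since \<open>le\<close> already speaks of the
  tripled cube, the measures of a cube and of its triple never have to be compared.\<close>

lemma weak_type_finite_cubes:
  fixes F :: "((real ^ 'n) \<times> real) set" and g :: "real ^ 'n \<Rightarrow> ennreal"
  assumes "finite F" "\<And>a l. (a, l) \<in> F \<Longrightarrow> 0 \<le> l"
    and M: "sets M = sets lebesgue" and g: "g \<in> borel_measurable M"
    and le: "\<And>a l. (a, l) \<in> F \<Longrightarrow> c * emeasure M (tripled a l) \<le> (\<integral>\<^sup>+y\<in>cube a l. g y \<partial>M)"
  shows "c * emeasure M (\<Union>(a, l)\<in>F. cube a l) \<le> (\<integral>\<^sup>+y. g y \<partial>M)"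
proof -
  obtain G where G: "G \<subseteq> F"
    "disjoint_family_on (\<lambda>(a, l). cube a l) G"
    "(\<Union>(a, l)\<in>F. cube a l) \<subseteq> (\<Union>(a, l)\<in>G. tripled a l)"
    using Vitali_covering_finite_cubes[of F] assms(1,2) by metis
  have fG: "finite G" using G(1) assms(1) finite_subset by blast
  have [measurable, simp]: "cube a l \<in> sets M" "tripled a l \<in> sets M" for a l
    by (simp_all add: M)
  note g[measurable]
  have "emeasure M (\<Union>(a, l)\<in>F. cube a l) \<le> emeasure M (\<Union>(a, l)\<in>G. tripled a l)"
    using fG G(3) by (intro emeasure_mono) (auto intro!: sets.finite_UN)
  also have "\<dots> \<le> (\<Sum>(a, l)\<in>G. emeasure M (tripled a l))"
    using emeasure_subadditive_finite[OF fG, of "\<lambda>(a, l). tripled a l" M]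
    by (simp add: split_def image_subset_iff)
  finally have "c * emeasure M (\<Union>(a, l)\<in>F. cube a l) \<le> c * (\<Sum>(a, l)\<in>G. emeasure M (tripled a l))"
    by (intro mult_left_mono) auto
  also have "\<dots> = (\<Sum>(a, l)\<in>G. c * emeasure M (tripled a l))"
    by (simp add: sum_distrib_left split_def)
  also have "\<dots> \<le> (\<Sum>(a, l)\<in>G. (\<integral>\<^sup>+y\<in>cube a l. g y \<partial>M))"
    using le G(1) by (intro sum_mono) auto
  also have "\<dots> = (\<integral>\<^sup>+y. (\<Sum>(a, l)\<in>G. g y * indicator (cube a l) y) \<partial>M)"
    by (simp add: split_def nn_integral_sum)
  also have "\<dots> \<le> (\<integral>\<^sup>+y. g y \<partial>M)"
  proof (rule nn_integral_mono)
    fix y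
    have "(\<Sum>(a, l)\<in>G. g y * indicator (cube a l) y) = g y * (\<Sum>q\<in>G. indicator (case q of (a, l) \<Rightarrow> cube a l) y)"
      by (simp add: sum_distrib_left split_def)
    \<comment> \<open>Over a disjoint family the indicators sum to the indicator of the union, hence
      to at most 1.\<close>
    also have "(\<Sum>q\<in>G. indicator (case q of (a, l) \<Rightarrow> cube a l) y)
        = (indicator (\<Union>q\<in>G. case q of (a, l) \<Rightarrow> cube a l) y :: ennreal)"
      by (rule indicator_UN_disjoint[OF fG G(2), symmetric])
    also have "g y * \<dots> \<le> g y" by (simp add: indicator_def)
    finally show "(\<Sum>(a, l)\<in>G. g y * indicator (cube a l) y) \<le> g y" .
  qed
  finally show ?thesis .
qed

text \<open>Continuity from below along the finite initial segments of an enumeration of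
  \<open>P\<close>.\<close>

lemma weak_type_countable_cubes:
  fixes P :: "((real ^ 'n) \<times> real) set" and g :: "real ^ 'n \<Rightarrow> ennreal"
  assumes P: "countable P" "\<And>a l. (a, l) \<in> P \<Longrightarrow> 0 \<le> l"
    and M: "sets M = sets lebesgue" and g: "g \<in> borel_measurable M"
    and le: "\<And>a l. (a, l) \<in> P \<Longrightarrow> c * emeasure M (tripled a l) \<le> (\<integral>\<^sup>+y\<in>cube a l. g y \<partial>M)"
  shows "c * emeasure M (\<Union>(a, l)\<in>P. cube a l) \<le> (\<integral>\<^sup>+y. g y \<partial>M)"
proof (cases "P = {}")
  case False
  define F where "F n = from_nat_into P ` {..n}" for n :: nat
  have FP: "F n \<subseteq> P" for n
    using from_nat_into[OF False] by (auto simp: F_def)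
  have U: "(\<Union>(a, l)\<in>P. cube a l) = (\<Union>n. \<Union>(a, l)\<in>F n. cube a l)"
  proof -
    have "P = (\<Union>n. F n)"
      using range_from_nat_into[OF False P(1)] unfolding F_def by blast
    then show ?thesis by (metis UN_UN_flatten)
  qed
  have meas: "(\<Union>(a, l)\<in>F n. cube a l) \<in> sets M" for n
    by (auto simp: M F_def split_def intro!: sets.finite_UN)
  have "incseq (\<lambda>n. \<Union>(a, l)\<in>F n. cube a l)"
    unfolding incseq_def F_def by (intro allI impI UN_mono image_mono) auto
  then have "emeasure M (\<Union>(a, l)\<in>P. cube a l) = (SUP n. emeasure M (\<Union>(a, l)\<in>F n. cube a l))"
    unfolding U using meas by (intro SUP_emeasure_incseq[symmetric]) auto
  then have "c * emeasure M (\<Union>(a, l)\<in>P. cube a l) = (SUP n. c * emeasure M (\<Union>(a, l)\<in>F n. cube a l))"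
    by (simp add: SUP_mult_left_ennreal)
  also have "\<dots> \<le> (\<integral>\<^sup>+y. g y \<partial>M)"
  proof (rule SUP_least, rule weak_type_finite_cubes)
    fix n
    show "finite (F n)" by (simp add: F_def)
    show "0 \<le> l" "c * emeasure M (tripled a l) \<le> (\<integral>\<^sup>+y\<in>cube a l. g y \<partial>M)" if "(a, l) \<in> F n" for a l
      using that FP P(2) le by blast+
  qed (use M g in auto)
  finally show ?thesis .
qed auto

text \<open>The indicator encodes "cubes that contain \<open>x\<close>" while the index set stays
  independent of \<open>x\<close>; for countable \<open>P\<close> the operator is thus a countable
  supremum of measurable functions.\<close>

definition dilated_maximal ::
    "(real ^ 'n) measure \<Rightarrow> ((real ^ 'n) \<times> real) set \<Rightarrow> (real ^ 'n \<Rightarrow> ennreal) \<Rightarrow> real ^ 'n \<Rightarrow> ennreal" where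
  "dilated_maximal M P g x =
    (SUP (a, l)\<in>P. indicator (cube a l) x * ((\<integral>\<^sup>+y\<in>cube a l. g y \<partial>M) / emeasure M (tripled a l)))"

lemma borel_measurable_dilated_maximal:
  assumes "countable P" "sets M = sets lebesgue"
  shows "dilated_maximal M P g \<in> borel_measurable M"
proof -
  have [measurable]: "cube a l \<in> sets M" for a l
    by (simp add: assms)
  show ?thesis
    unfolding dilated_maximal_def using assms(1)
    by (intro borel_measurable_SUP) (auto simp: split_def)
qed

lemma dilated_maximal_ge:
  assumes "(a, l) \<in> P" "x \<in> cube a l"
  shows "(\<integral>\<^sup>+y\<in>cube a l. g y \<partial>M) / emeasure M (tripled a l) \<le> dilated_maximal M P g x"
  unfolding dilated_maximal_def using assms by (intro SUP_upper2[OF assms(1)]) auto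

text \<open>Only the weak type with truncation is to be shown. With \<open>h\<close> the part of
  \<open>g\<close> above \<open>t / 2\<close>, one has \<open>g \<le> h + t / 2\<close>. On a cube
  whose quotient exceeds \<open>t\<close>, the term \<open>t / 2\<close> accounts for at most half
  of \<open>t\<close> times the mass of the triple, so \<open>h\<close> accounts for the other half
  and the weak bound for countable families applies to \<open>h\<close>.\<close>

theorem dilated_maximal_strong_type:
  fixes P :: "((real ^ 'n) \<times> real) set" and g :: "real ^ 'n \<Rightarrow> ennreal"
  assumes P: "countable P" "\<And>a l. (a, l) \<in> P \<Longrightarrow> 0 < l"
    and M: "sets M = sets lebesgue" and fin: "\<And>a l. 0 < l \<Longrightarrow> emeasure M (cube a l) < \<infinity>"
    and g: "g \<in> borel_measurable M" and r: "1 < r"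
  shows "(\<integral>\<^sup>+x. epowr (dilated_maximal M P g x) r \<partial>M)
    \<le> ennreal (r / (r - 1) * 2 powr r) * (\<integral>\<^sup>+x. epowr (g x) r \<partial>M)"
proof (rule weak_type_imp_strong_type)
  have [measurable, simp]: "cube a l \<in> sets M" "tripled a l \<in> sets M" for a l
    by (simp_all add: M)
  have spaceM: "space M = UNIV"
    using sets_eq_imp_space_eq[OF M] by simp
  show "sigma_finite_measure M"
  proof
    show "\<exists>B. countable B \<and> B \<subseteq> sets M \<and> \<Union> B = space M \<and> (\<forall>b\<in>B. emeasure M b \<noteq> \<infinity>)"
      using fin by (intro exI[of _ "range central_cube"]) (auto simp: central_cube_def UN_central_cube[unfolded central_cube_def] spaceM less_top)
  qed
  show "dilated_maximal M P g \<in> borel_measurable M"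
    by (intro borel_measurable_dilated_maximal P M)
  show "g \<in> borel_measurable M" "1 < r" by fact+
  note g[measurable]
  fix t :: real assume t: "0 < t"
  define h where "h x = g x * indicator {x. ennreal t < 2 * g x} x" for x
  have [measurable]: "h \<in> borel_measurable M" unfolding h_def by measurable
  define P' where "P' = {(a, l) \<in> P. ennreal t < (\<integral>\<^sup>+y\<in>cube a l. g y \<partial>M) / emeasure M (tripled a l)}"
  have "{x \<in> space M. ennreal t < dilated_maximal M P g x} \<subseteq> (\<Union>(a, l)\<in>P'. cube a l)"
  proof
    fix x assume "x \<in> {x \<in> space M. ennreal t < dilated_maximal M P g x}"
    then obtain a l where "(a, l) \<in> P"
      "ennreal t < indicator (cube a l) x * ((\<integral>\<^sup>+y\<in>cube a l. g y \<partial>M) / emeasure M (tripled a l))"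
      by (auto simp: dilated_maximal_def less_SUP_iff)
    then show "x \<in> (\<Union>(a, l)\<in>P'. cube a l)"
      by (cases "x \<in> cube a l") (auto simp: P'_def)
  qed
  then have "emeasure M {x \<in> space M. ennreal t < dilated_maximal M P g x}
      \<le> emeasure M (\<Union>(a, l)\<in>P'. cube a l)"
    using countable_subset[OF _ P(1), of P']
    by (intro emeasure_mono sets.countable_UN') (auto simp: P'_def)
  then have "ennreal (t / 2) * emeasure M {x \<in> space M. ennreal t < dilated_maximal M P g x}
      \<le> ennreal (t / 2) * emeasure M (\<Union>(a, l)\<in>P'. cube a l)"
    by (intro mult_left_mono) auto
  also have "\<dots> \<le> (\<integral>\<^sup>+y. h y \<partial>M)"
  proof (rule weak_type_countable_cubes)
    show "countable P'" using P(1) by (rule countable_subset[rotated]) (auto simp: P'_def)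
    show "0 \<le> l" if "(a, l) \<in> P'" for a l using that P(2) by (auto simp: P'_def less_imp_le)
    show "sets M = sets lebesgue" "h \<in> borel_measurable M" by (fact, measurable)
    fix a :: "real ^ 'n" and l assume al: "(a, l) \<in> P'"
    then have l: "0 < l" using P by (auto simp: P'_def)
    let ?m = "emeasure M (tripled a l)"
    have lt: "ennreal t < (\<integral>\<^sup>+y\<in>cube a l. g y \<partial>M) / ?m" using al by (simp add: P'_def)
    \<comment> \<open>If the triple is null the claim is trivial, so the division can be undone in
      every case.\<close>
    have *: "ennreal t * ?m \<le> (\<integral>\<^sup>+y\<in>cube a l. g y \<partial>M)"
    proof (rule ccontr)
      assume neg: "\<not> ?thesis"
      then have "0 < ?m" by (metis mult_zero_right not_gr_zero zero_le)
      from divide_le_posI_ennreal[OF this, of "\<integral>\<^sup>+y\<in>cube a l. g y \<partial>M" "ennreal t"] neg lt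
      show False by (simp add: not_le mult.commute) (meson leD less_imp_le)
    qed
    have "?m < \<infinity>" using l fin by (simp add: tripled_def)
    have "(\<integral>\<^sup>+y\<in>cube a l. g y \<partial>M) \<le> (\<integral>\<^sup>+y\<in>cube a l. (h y + ennreal (t / 2)) \<partial>M)"
    proof (intro nn_integral_mono mult_right_mono)
      fix y
      have "2 * g y \<le> ennreal t \<Longrightarrow> g y \<le> ennreal (t / 2)"
      proof (cases "g y")
        case (real z)
        assume "2 * g y \<le> ennreal t"
        then have "ennreal (2 * z) \<le> ennreal t" using real by (simp add: ennreal_mult)
        then show ?thesis using t real by simp
      next
        case top
        assume "2 * g y \<le> ennreal t"
        then show ?thesis using top by (simp add: ennreal_mult_top top_unique)
      qed
      then show "g y \<le> h y + ennreal (t / 2)"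
        by (auto simp: h_def indicator_def not_less)
    qed auto
    also have "\<dots> = (\<integral>\<^sup>+y\<in>cube a l. h y \<partial>M) + ennreal (t / 2) * emeasure M (cube a l)"
      by (simp add: distrib_right nn_integral_add nn_integral_cmult_indicator)
    also have "\<dots> \<le> (\<integral>\<^sup>+y\<in>cube a l. h y \<partial>M) + ennreal (t / 2) * ?m"
      using l by (intro add_left_mono mult_left_mono emeasure_mono cube_subset_tripled) auto
    finally have le: "(\<integral>\<^sup>+y\<in>cube a l. g y \<partial>M) \<le> (\<integral>\<^sup>+y\<in>cube a l. h y \<partial>M) + ennreal (t / 2) * ?m" .
    have "ennreal (t / 2) * ?m + ennreal (t / 2) * ?m = ennreal t * ?m"
      using t by (simp add: distrib_right[symmetric] ennreal_plus[symmetric] del: ennreal_plus)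
    also note *
    also note le
    finally have "ennreal (t / 2) * ?m + ennreal (t / 2) * ?m \<le> ennreal (t / 2) * ?m + (\<integral>\<^sup>+y\<in>cube a l. h y \<partial>M)"
      by (simp only: add.commute)
    \<comment> \<open>Local finiteness enters here: a summand can be cancelled only if it is
      finite.\<close>
    moreover have "ennreal (t / 2) * ?m \<noteq> \<infinity>" using \<open>?m < \<infinity>\<close> by (simp add: ennreal_mult_eq_top_iff)
    ultimately show "ennreal (t / 2) * ?m \<le> (\<integral>\<^sup>+y\<in>cube a l. h y \<partial>M)"
      by (simp only: ennreal_add_left_cancel_le) simp
  qed
  finally have "2 * (ennreal (t / 2) * emeasure M {x \<in> space M. ennreal t < dilated_maximal M P g x})
      \<le> 2 * (\<integral>\<^sup>+y. h y \<partial>M)" by (intro mult_left_mono) auto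
  moreover have "2 * ennreal (t / 2) = ennreal t"
    using ennreal_mult[of 2 "t / 2"] t by simp
  ultimately show "ennreal t * emeasure M {x \<in> space M. ennreal t < dilated_maximal M P g x}
      \<le> 2 * (\<integral>\<^sup>+x. g x * indicator {x. ennreal t < 2 * g x} x \<partial>M)"
    by (simp add: h_def mult.assoc[symmetric])
qed

section \<open>Comparison of measures on cubes\<close>

text \<open>Cover \<open>S\<close> by countably many dyadic subcubes that lie in \<open>U\<close>
  and have disjoint interiors. \<open>N\<close> is subadditive over them, while \<open>M\<close> is
  additive because it ignores their boundaries, which are Lebesgue null.\<close>

lemma cubes_cover_le:
  fixes M N :: "(real ^ 'n) measure"
  assumes M: "sets M = sets lebesgue" and N: "sets N = sets lebesgue"
    and ac: "null_sets lebesgue \<subseteq> null_sets M"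
    and le: "\<And>a l. 0 < l \<Longrightarrow> emeasure N (cube a l) \<le> emeasure M (cube a l)"
    and S: "S \<in> sets lebesgue" "S \<subseteq> cube a l" "0 < l" and U: "open U" "S \<subseteq> U"
  shows "emeasure N S \<le> emeasure M (U \<inter> cube a l)"
proof -
  \<comment> \<open>With this gauge, a box of the covering lemma that is attached to a point of
    \<open>S\<close> lies in \<open>U\<close>.\<close>
  define g where "g x = (if x \<in> U then U else UNIV)" for x
  have g: "gauge g" using U by (auto simp: gauge_def g_def)
  have "S \<subseteq> cbox a (a + (\<chi> i. l))" "box a (a + (\<chi> i. l)) \<noteq> {}"
    using S by (auto simp: cube_def interval_ne_empty_cart)
  from covering_lemma[OF this g] obtain \<D> where D: "countable \<D>"
    "\<Union>\<D> \<subseteq> cube a l" "\<And>K. K \<in> \<D> \<Longrightarrow> interior K \<noteq> {} \<and> (\<exists>c d. K = cbox c d)"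
    "pairwise (\<lambda>A B. interior A \<inter> interior B = {}) \<D>"
    "\<And>K. K \<in> \<D> \<Longrightarrow> \<exists>x \<in> S \<inter> K. K \<subseteq> g x"
    "\<And>u v. cbox u v \<in> \<D> \<Longrightarrow> \<exists>n. \<forall>i \<in> Basis. v \<bullet> i - u \<bullet> i = ((a + (\<chi> i. l)) \<bullet> i - a \<bullet> i) / 2^n"
    "S \<subseteq> \<Union>\<D>"
    by (metis cube_def)
  \<comment> \<open>The boxes arise by bisecting the original cube \<open>n\<close> times in every
    coordinate, so all their sides equal \<open>l / 2 ^ n\<close>.\<close>
  have isc: "\<exists>c m. 0 < m \<and> K = cube c m" if K: "K \<in> \<D>" for K
  proof -
    obtain c d where cd: "K = cbox c d" using D(3)[OF K] by blast
    obtain n where n: "\<And>i. i \<in> Basis \<Longrightarrow> d \<bullet> i - c \<bullet> i = ((a + (\<chi> i. l)) \<bullet> i - a \<bullet> i) / 2^n"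
      using D(6) K cd by metis
    have "d $ i = c $ i + l / 2 ^ n" for i
      using n[of "axis i 1"] by (simp add: axis_in_Basis_iff inner_axis)
    then have "d = c + (\<chi> i. l / 2 ^ n)" by (simp add: vec_eq_iff)
    then show ?thesis using S(3) cd by (intro exI[of _ c] exI[of _ "l / 2 ^ n"]) (simp add: cube_def)
  qed
  have sub: "K \<subseteq> U \<inter> cube a l" if "K \<in> \<D>" for K
    using D(2) D(5)[OF that] U(2) that by (auto simp: g_def split: if_splits)
  have Kle: "emeasure N K \<le> emeasure M (interior K)" if K: "K \<in> \<D>" for K
  proof -
    obtain c m where cm: "0 < m" "K = cube c m" using isc[OF K] by blast
    have "K - interior K \<in> null_sets lebesgue"
      using negligible_convex_frontier[of K] cm by (simp add: negligible_iff_null_sets frontier_def cube_def)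
    then have diff_null: "K - interior K \<in> null_sets M" using ac by blast
    have "interior K \<in> sets M" using M by simp
    then have "emeasure M (interior K \<union> (K - interior K)) = emeasure M (interior K)"
      using diff_null by (rule emeasure_Un_null_set)
    moreover have "interior K \<union> (K - interior K) = K" using interior_subset by blast
    ultimately have "emeasure M K = emeasure M (interior K)" by metis
    then show ?thesis using le[OF cm(1), of c] cm(2) by metis
  qed
  have Kset: "K \<in> sets N" "K \<in> sets M" "interior K \<in> sets M" if K: "K \<in> \<D>" for K
  proof -
    obtain c m where "K = cube c m" using isc[OF K] by blast
    then have "K \<in> sets lebesgue" by simp
    then show "K \<in> sets N" "K \<in> sets M" by (simp_all only: M N)
    have "interior K \<in> sets lebesgue" by simp
    then show "interior K \<in> sets M" by (simp only: M)
  qed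
  have fin: "emeasure N (\<Union>F) \<le> emeasure M (U \<inter> cube a l)" if F: "finite F" "F \<subseteq> \<D>" for F
  proof -
    have "emeasure N (\<Union>F) \<le> (\<Sum>K\<in>F. emeasure N K)"
      using emeasure_subadditive_finite[of F "\<lambda>K. K" N] F Kset by auto
    also have "\<dots> \<le> (\<Sum>K\<in>F. emeasure M (interior K))"
      using F Kle by (intro sum_mono) auto
    also have "\<dots> = emeasure M (\<Union>K\<in>F. interior K)"
    proof (rule sum_emeasure)
      show "disjoint_family_on interior F"
        using D(4) F(2) unfolding disjoint_family_on_def pairwise_def by blast
    qed (use F Kset in auto)
    also have "\<dots> \<le> emeasure M (U \<inter> cube a l)"
      using sub F(2) interior_subset U(1) M by (intro emeasure_mono) (blast, auto intro!: sets.Int)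
    finally show ?thesis .
  qed
  show ?thesis
  proof (cases "\<D> = {}")
    case False
    define F where "F n = from_nat_into \<D> ` {..n}" for n :: nat
    have F: "finite (F n)" "F n \<subseteq> \<D>" for n
      using from_nat_into[OF False] by (auto simp: F_def)
    have UF: "\<D> = (\<Union>n. F n)"
      using range_from_nat_into[OF False D(1)] unfolding F_def by blast
    have "incseq (\<lambda>n. \<Union>(F n))"
      unfolding incseq_def F_def by (intro allI impI Union_mono image_mono) auto
    moreover have "range (\<lambda>n. \<Union>(F n)) \<subseteq> sets N"
      using F Kset by (auto intro!: sets.finite_Union)
    ultimately have "emeasure N (\<Union>n. \<Union>(F n)) = (SUP n. emeasure N (\<Union>(F n)))"
      by (intro SUP_emeasure_incseq[symmetric]) auto
    also have "\<dots> \<le> emeasure M (U \<inter> cube a l)"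
      using F fin by (intro SUP_least) auto
    also have "(\<Union>n. \<Union>(F n)) = \<Union>(\<Union>n. F n)" by blast
    also have "\<dots> = \<Union>\<D>" by (simp only: UF[symmetric])
    finally have "emeasure N (\<Union>\<D>) \<le> emeasure M (U \<inter> cube a l)" .
    moreover have "emeasure N S \<le> emeasure N (\<Union>\<D>)"
      using D(1,7) Kset by (intro emeasure_mono sets.countable_Union) auto
    ultimately show ?thesis by order
  qed (use D(7) in auto)
qed

text \<open>Outer regularity: a bounded \<open>S\<close> is, up to a null set, the intersection of
  decreasing open sets, to which the covering bound applies; finiteness of \<open>M\<close> on cubes
  gives continuity from above. The general case follows by exhaustion with central cubes.\<close>

lemma emeasure_le_if_le_on_cubes:
  fixes M N :: "(real ^ 'n) measure"
  assumes M: "sets M = sets lebesgue" and N: "sets N = sets lebesgue"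
    and fin: "\<And>a l. 0 < l \<Longrightarrow> emeasure M (cube a l) < \<infinity>"
    and ac: "null_sets lebesgue \<subseteq> null_sets M"
    and le: "\<And>a l. 0 < l \<Longrightarrow> emeasure N (cube a l) \<le> emeasure M (cube a l)"
    and S: "S \<in> sets lebesgue"
  shows "emeasure N S \<le> emeasure M S"
proof -
  have bounded: "emeasure N S \<le> emeasure M S"
    if S: "S \<in> sets lebesgue" "S \<subseteq> cube a l" "0 < l" for S a l
  proof -
    obtain C T where CT: "gdelta C" "T \<in> null_sets lebesgue" "S \<union> T = C" "disjnt S T"
      using lebesgue_set_almost_gdelta[OF S(1)] by blast
    obtain F :: "nat \<Rightarrow> (real ^ 'n) set" where F: "\<And>n. open (F n)" "C = (\<Inter>n. F n)"
      using CT(1) by (cases rule: gdelta.cases) auto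
    \<comment> \<open>Finite intersections make the open sets decreasing without changing the
      intersection.\<close>
    define V where "V n = (\<Inter>i\<le>n. F i)" for n
    have V: "open (V n)" "S \<subseteq> V n" for n
      using F CT(3) by (auto simp: V_def)
    have "decseq (\<lambda>n. V n \<inter> cube a l)"
      by (force simp: V_def decseq_def)
    moreover have "V n \<inter> cube a l \<in> sets M" for n
      using V(1) M by (auto intro!: sets.Int)
    moreover have "emeasure M (V n \<inter> cube a l) \<noteq> \<infinity>" for n
      using emeasure_mono[of "V n \<inter> cube a l" "cube a l" M] fin[OF S(3), of a] M by (auto simp: top_unique)
    ultimately have "(INF n. emeasure M (V n \<inter> cube a l)) = emeasure M (\<Inter>n. V n \<inter> cube a l)"
      by (intro INF_emeasure_decseq) auto
    moreover have "emeasure N S \<le> emeasure M (V n \<inter> cube a l)" for n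
      by (rule cubes_cover_le[OF M N ac le S V])
    then have "emeasure N S \<le> (INF n. emeasure M (V n \<inter> cube a l))"
      by (rule INF_greatest)
    moreover have "(\<Inter>n. V n \<inter> cube a l) \<subseteq> S \<union> T"
      using CT(3) F(2) by (auto simp: V_def)
    then have "emeasure M (\<Inter>n. V n \<inter> cube a l) \<le> emeasure M (S \<union> T)"
      using CT S M by (intro emeasure_mono) auto
    moreover have "emeasure M (S \<union> T) = emeasure M S"
      using CT(2) ac S M by (intro emeasure_Un_null_set) auto
    ultimately show ?thesis by simp
  qed
  define A where "A n = S \<inter> central_cube n" for n
  have A: "A n \<in> sets lebesgue" for n
    using S by (simp add: A_def central_cube_def)
  have "incseq A" using incseq_central_cube by (auto simp: A_def incseq_def)
  moreover have UA: "(\<Union>n. A n) = S"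
    using UN_central_cube by (auto simp: A_def)
  ultimately have "emeasure N S = (SUP n. emeasure N (A n))"
    using A N SUP_emeasure_incseq[of A N] by (auto simp: image_subset_iff)
  also have "\<dots> \<le> emeasure M S"
  proof (rule SUP_least)
    fix n
    have "emeasure N (A n) \<le> emeasure M (A n)"
      by (rule bounded[OF A, of n "\<chi> i. - real n" "2 * real n + 1"]) (auto simp: A_def central_cube_def)
    also have "\<dots> \<le> emeasure M S"
      using S M by (intro emeasure_mono) (auto simp: A_def)
    finally show "emeasure N (A n) \<le> emeasure M S" .
  qed
  finally show ?thesis .
qed

text \<open>Does the work of Lebesgue differentiation. Comparing the two densities extends the
  inequality from cubes to all measurable sets; on the set where \<open>u < v\<close> it forces the
  integral of \<open>v - u\<close> to vanish.\<close>

lemma AE_le_if_le_on_cubes: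
  fixes u v :: "real ^ 'n \<Rightarrow> ennreal"
  assumes [measurable]: "u \<in> borel_measurable lebesgue" "v \<in> borel_measurable lebesgue"
    and fin: "\<And>a l. 0 < l \<Longrightarrow> (\<integral>\<^sup>+x\<in>cube a l. u x \<partial>lebesgue) < \<infinity>"
    and le: "\<And>a l. 0 < l \<Longrightarrow> (\<integral>\<^sup>+x\<in>cube a l. v x \<partial>lebesgue) \<le> (\<integral>\<^sup>+x\<in>cube a l. u x \<partial>lebesgue)"
  shows "AE x in lebesgue. v x \<le> u x"
proof -
  have main: "(\<integral>\<^sup>+x\<in>S. v x \<partial>lebesgue) \<le> (\<integral>\<^sup>+x\<in>S. u x \<partial>lebesgue)" if S: "S \<in> sets lebesgue" for S
  proof -
    have "emeasure (density lebesgue v) S \<le> emeasure (density lebesgue u) S"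
    proof (rule emeasure_le_if_le_on_cubes)
      show "null_sets lebesgue \<subseteq> null_sets (density lebesgue u)"
        using absolutely_continuousI_density[of u lebesgue] by (simp add: absolutely_continuous_def)
    qed (use fin le S in \<open>simp_all add: emeasure_density\<close>)
    then show ?thesis using S by (simp add: emeasure_density)
  qed
  \<comment> \<open>Cutting to a central cube makes the integral of \<open>u\<close> finite, so that
    it may be subtracted.\<close>
  define E where "E n = {x \<in> central_cube n. u x < v x}" for n
  have E[measurable]: "E n \<in> sets lebesgue" for n
  proof -
    have "E n = central_cube n \<inter> {x \<in> space lebesgue. u x < v x}" by (auto simp: E_def)
    then show ?thesis by (simp add: central_cube_def)
  qed
  have "E n \<in> null_sets lebesgue" for n
  proof -
    have fE: "(\<integral>\<^sup>+x\<in>E n. u x \<partial>lebesgue) < \<infinity>"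
    proof -
      have "(\<integral>\<^sup>+x\<in>E n. u x \<partial>lebesgue) \<le> (\<integral>\<^sup>+x\<in>central_cube n. u x \<partial>lebesgue)"
        by (intro nn_integral_mono) (auto simp: E_def indicator_def)
      also have "\<dots> < \<infinity>" unfolding central_cube_def by (rule fin) simp
      finally show ?thesis .
    qed
    have "(\<integral>\<^sup>+x\<in>E n. (v x - u x) \<partial>lebesgue) = (\<integral>\<^sup>+x. v x * indicator (E n) x - u x * indicator (E n) x \<partial>lebesgue)"
      by (intro nn_integral_cong) (auto simp: indicator_def)
    also have "\<dots> = (\<integral>\<^sup>+x\<in>E n. v x \<partial>lebesgue) - (\<integral>\<^sup>+x\<in>E n. u x \<partial>lebesgue)"
    proof (rule nn_integral_diff)
      show "AE x in lebesgue. u x * indicator (E n) x \<le> v x * indicator (E n) x"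
        by (auto simp: E_def indicator_def)
    qed (use fE in auto)
    also have "\<dots> = 0"
      using main[OF E] le_less_trans[OF main[OF E] fE] by (simp add: diff_eq_0_iff_ennreal)
    finally have "AE x in lebesgue. (v x - u x) * indicator (E n) x = 0"
      by (subst (asm) nn_integral_0_iff_AE) auto
    then have "AE x in lebesgue. x \<notin> E n"
    proof eventually_elim
      case (elim x)
      then show ?case
        by (auto simp: E_def indicator_def diff_eq_0_iff_ennreal split: if_splits)
    qed
    then show ?thesis by (simp add: AE_iff_null_sets)
  qed
  then have "(\<Union>n. E n) \<in> null_sets lebesgue" by (intro null_sets_UN') auto
  then have "AE x in lebesgue. x \<notin> (\<Union>n. E n)" by (rule AE_not_in)
  then show ?thesis
  proof eventually_elim
    case (elim x)
    obtain n where "x \<in> central_cube n" using UN_central_cube by blast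
    with elim show ?case by (auto simp: E_def not_less)
  qed
qed

section \<open>A two-weight bound for the maximal function\<close>

text \<open>Corners from a countable dense set and rational sides. The new corner is less than
  \<open>l\<close> below the old one in each coordinate, so a side above \<open>2 * l\<close>
  suffices to contain the old cube, and there is room to keep it below \<open>3 * l\<close>.\<close>

lemma countable_cube_family:
  obtains P :: "((real ^ 'n) \<times> real) set"
  where "countable P" "\<And>a l. (a, l) \<in> P \<Longrightarrow> 0 < l"
    "\<And>a l. 0 < l \<Longrightarrow> \<exists>b m. (b, m) \<in> P \<and> cube a l \<subseteq> cube b m \<and> m \<le> 3 * l"
proof -
  obtain D :: "(real ^ 'n) set" where D: "countable D" "\<And>X. open X \<Longrightarrow> X \<noteq> {} \<Longrightarrow> \<exists>d\<in>D. d \<in> X"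
    using countable_dense_exists by blast
  show thesis
  proof
    show "countable (D \<times> (\<rat> \<inter> {0<..}))"
      using D(1) countable_rat by (intro countable_SIGMA countable_Int1) auto
    show "0 < l" if "(a, l) \<in> D \<times> (\<rat> \<inter> {0<..})" for a l using that by auto
    fix a :: "real ^ 'n" and l :: real assume l: "0 < l"
    have "box (a - (\<chi> i. l)) a \<noteq> {}" using l by (simp add: interval_ne_empty_cart)
    then obtain b where b: "b \<in> D" "b \<in> box (a - (\<chi> i. l)) a" using D(2)[OF open_box] by blast
    obtain m where m: "m \<in> \<rat>" "2 * l < m" "m < 3 * l"
      using Rats_dense_in_real[of "2 * l" "3 * l"] l by auto
    have "cube a l \<subseteq> cube b m"
    proof
      fix x assume x: "x \<in> cube a l"
      show "x \<in> cube b m"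
        unfolding mem_cube
      proof
        fix i
        have "a $ i \<le> x $ i \<and> x $ i \<le> a $ i + l" "a $ i - l < b $ i \<and> b $ i < a $ i"
          using x b(2) by (simp_all add: mem_cube mem_box_cart)
        then show "b $ i \<le> x $ i \<and> x $ i \<le> b $ i + m" using m(2) by linarith
      qed
    qed
    then show "\<exists>b m. (b, m) \<in> D \<times> (\<rat> \<inter> {0<..}) \<and> cube a l \<subseteq> cube b m \<and> m \<le> 3 * l"
      using b(1) m l by (intro exI[of _ b] exI[of _ m]) auto
  qed
qed

text \<open>The integral grows with the cube, and the volume grows by at most the dimensional factor
  \<open>3 ^ CARD('n)\<close>. This is the price of replacing arbitrary cubes by those of a
  countable family.\<close>

lemma average_cube_le:
  fixes a b :: "real ^ 'n"
  assumes "0 < l" "cube a l \<subseteq> cube b m" "m \<le> 3 * l"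
  shows "average (cube a l) g \<le> ennreal (3 ^ CARD('n)) * average (cube b m) g"
proof -
  have m: "0 < m"
  proof -
    have "a \<in> cube a l" "a + (\<chi> i. l) \<in> cube a l" using assms(1) by (auto simp: mem_cube)
    then have "a \<in> cube b m" "a + (\<chi> i. l) \<in> cube b m" using assms(2) by auto
    then have "b $ i \<le> a $ i \<and> a $ i + l \<le> b $ i + m" for i
      by (simp add: mem_cube)
    \<comment> \<open>\<open>undefined\<close> only names some coordinate.\<close>
    from this[of undefined] show ?thesis using assms(1) by linarith
  qed
  let ?I = "\<integral>\<^sup>+x\<in>cube b m. g x \<partial>lebesgue"
  have "average (cube a l) g \<le> ?I / ennreal (l ^ CARD('n))"
    unfolding average_def using assms
    by (subst emeasure_cube) (auto intro!: divide_right_mono_ennreal nn_integral_mono simp: indicator_def)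
  also have "\<dots> \<le> ennreal (3 ^ CARD('n)) * (?I / ennreal (m ^ CARD('n)))"
  proof -
    have "inverse (l ^ CARD('n)) = 3 ^ CARD('n) / (3 * l) ^ CARD('n)"
      by (simp add: power_mult_distrib field_simps)
    also have "\<dots> \<le> 3 ^ CARD('n) / m ^ CARD('n)"
      using assms m by (intro divide_left_mono power_mono) auto
    finally have "ennreal (inverse (l ^ CARD('n))) \<le> ennreal (3 ^ CARD('n) * inverse (m ^ CARD('n)))"
      by (intro ennreal_leI) (simp add: field_simps)
    then have "?I * ennreal (inverse (l ^ CARD('n))) \<le> ?I * (ennreal (3 ^ CARD('n)) * ennreal (inverse (m ^ CARD('n))))"
      using m by (intro mult_left_mono) (auto simp: ennreal_mult)
    then show ?thesis
      using m assms(1) by (simp add: divide_ennreal_def inverse_ennreal mult_ac)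
  qed
  also have "\<dots> = ennreal (3 ^ CARD('n)) * average (cube b m) g"
    using m by (simp add: average_def emeasure_cube del: emeasure_completion)
  finally show ?thesis .
qed

lemma ennreal_mult_divide_cancel:
  fixes a b :: ennreal
  assumes "0 < b" "b < \<infinity>"
  shows "b * (a / b) = a"
  using assms ennreal_mult_divide_eq[of b a]
  by (simp add: ennreal_times_divide mult.commute[of b a] less_top)

lemma set_nn_integral_pos:
  assumes "AE x in M. 0 < (v x :: ennreal)" "v \<in> borel_measurable M" "Q \<in> sets M" "0 < emeasure M Q"
  shows "0 < (\<integral>\<^sup>+x\<in>Q. v x \<partial>M)"
proof (rule ccontr)
  note assms(2,3)[measurable]
  assume "\<not> ?thesis"
  then have "AE x in M. v x * indicator Q x = 0"
    by (subst (asm) not_gr_zero, subst (asm) nn_integral_0_iff_AE) auto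
  with assms(1) have "AE x in M. x \<notin> Q"
    by eventually_elim (auto simp: indicator_def split: if_splits)
  then have "Q \<in> null_sets M" using assms(3) AE_iff_null_sets by blast
  with assms(4) show False by auto
qed

text \<open>The scalar core of Lerner's argument. Here \<open>c\<close> is the volume of a cube,
  \<open>d * c\<close> that of its triple, \<open>S\<close> and \<open>V\<close> are the masses of
  the triple, and \<open>I\<close> is the integral of the function. Factor \<open>I / c\<close> as
  \<open>(I / S) * (S / c)\<close> and bound the power of \<open>S / c\<close> by the Muckenhoupt
  condition on the triple.\<close>

lemma ennreal_power_mean_step:
  fixes I S V K :: ennreal and c d :: real
  assumes p: "1 < p" and c: "0 < c" "0 < d"
    and S: "0 < S" "S < \<infinity>" and V: "0 < V" "V < \<infinity>" and K: "K < \<infinity>"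
    and le: "V * epowr S (p - 1) \<le> K * epowr (ennreal (d * c)) p"
  shows "epowr (I / ennreal c) (p - 1) \<le>
    K * ennreal (d powr p) * ((epowr (I / S) (p - 1) * ennreal c) / V)"
proof -
  obtain s where s: "S = ennreal s" "0 < s" using S by (cases S) auto
  obtain v where v: "V = ennreal v" "0 < v" using V by (cases V) auto
  obtain k where k: "K = ennreal k" "0 \<le> k" using K by (cases K) auto
  have "ennreal (v * s powr (p - 1)) \<le> ennreal (k * (d * c) powr p)"
    using le c s v k by (simp add: ennreal_mult[symmetric])
  then have "v * s powr (p - 1) \<le> k * (d powr p * c powr p)"
    using c k by (simp add: ennreal_le_iff powr_mult)
  then have real_le: "(s / c) powr (p - 1) \<le> k * d powr p * (c / v)"
    using c s v by (simp add: powr_divide powr_diff field_simps)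
  have "I / ennreal c = I / S * ennreal (s / c)"
    using c s by (simp add: divide_ennreal_def inverse_ennreal mult.assoc ennreal_mult[symmetric] field_simps)
  then have "epowr (I / ennreal c) (p - 1) = epowr (I / S) (p - 1) * ennreal ((s / c) powr (p - 1))"
    using c s by (simp add: epowr_mult)
  also have "\<dots> \<le> epowr (I / S) (p - 1) * ennreal (k * d powr p * (c / v))"
    using real_le by (intro mult_left_mono ennreal_leI) auto
  also have "\<dots> = K * ennreal (d powr p) * ((epowr (I / S) (p - 1) * ennreal c) / V)"
    using c s v k by (simp add: divide_ennreal_def inverse_ennreal ennreal_mult mult_ac divide_inverse)
  finally show ?thesis .
qed

text \<open>After the pointwise bound the strong type theorem is used twice: for \<open>v\<close>
  with the exponent conjugate to \<open>p\<close>, then for \<open>s\<close> with \<open>p\<close>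
  itself; \<open>vs\<close> connects the two. The conclusion offers a measurable majorant
  \<open>H\<close>, because the later change of variables is stated for measurable
  functions.\<close>

theorem two_weight_maximal_bound:
  fixes v s :: "real ^ 'n \<Rightarrow> ennreal"
  assumes p: "1 < p" and K: "K < \<infinity>" and L: "L < \<infinity>"
    and v [measurable]: "v \<in> borel_measurable lebesgue" "AE x in lebesgue. 0 < v x" "\<And>x. v x < \<infinity>"
    and s [measurable]: "s \<in> borel_measurable lebesgue" "AE x in lebesgue. 0 < s x" "\<And>x. s x < \<infinity>"
    and Ap: "\<And>Q. Q \<in> cubes \<Longrightarrow> (\<integral>\<^sup>+x\<in>Q. v x \<partial>lebesgue) * epowr (\<integral>\<^sup>+x\<in>Q. s x \<partial>lebesgue) (p - 1)
      \<le> K * epowr (emeasure lebesgue Q) p"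
    and vs: "AE x in lebesgue. epowr (inverse (v x)) (1 / (p - 1)) \<le> L * s x"
  obtains C where "C < \<infinity>"
    "\<And>f. f \<in> borel_measurable lebesgue \<Longrightarrow> \<exists>H \<in> borel_measurable lebesgue.
      (\<forall>x. epowr (maximal_function f x) p \<le> H x) \<and>
      (\<integral>\<^sup>+x. H x * v x \<partial>lebesgue) \<le> C * (\<integral>\<^sup>+x. epowr (ennreal \<bar>f x\<bar> / s x) p * s x \<partial>lebesgue)"
proof -
  obtain P :: "((real ^ 'n) \<times> real) set" where P: "countable P" "\<And>a l. (a, l) \<in> P \<Longrightarrow> 0 < l"
    "\<And>a l. 0 < l \<Longrightarrow> \<exists>b m. (b, m) \<in> P \<and> cube a l \<subseteq> cube b m \<and> m \<le> 3 * l"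
    using countable_cube_family by blast
  \<comment> \<open>The exponent conjugate to \<open>p\<close>.\<close>
  define q where "q = p / (p - 1)"
  have q: "1 < q" "q = 1 + 1 / (p - 1)" "(p - 1) * q = p" "1 / (p - 1) * p = q"
    using p by (auto simp: q_def field_simps)
  define Mv where "Mv = density lebesgue v"
  define Ms where "Ms = density lebesgue s"
  have sets: "sets Mv = sets lebesgue" "sets Ms = sets lebesgue"
    by (simp_all add: Mv_def Ms_def)
  have Mv: "emeasure Mv X = (\<integral>\<^sup>+x\<in>X. v x \<partial>lebesgue)" if "X \<in> sets lebesgue" for X
    using that by (simp add: Mv_def emeasure_density)
  have Ms: "emeasure Ms X = (\<integral>\<^sup>+x\<in>X. s x \<partial>lebesgue)" if "X \<in> sets lebesgue" for X
    using that by (simp add: Ms_def emeasure_density)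
  have pos: "0 < emeasure Mv (cube a l)" "0 < emeasure Ms (cube a l)" if "0 < l" for a l
  proof -
    have c: "0 < emeasure lebesgue (cube a l)" using that by (subst emeasure_cube) auto
    show "0 < emeasure Mv (cube a l)" "0 < emeasure Ms (cube a l)"
      unfolding Mv[OF sets_cube(1)] Ms[OF sets_cube(1)]
      using set_nn_integral_pos[OF v(2,1) _ c] set_nn_integral_pos[OF s(2,1) _ c] by auto
  qed
  \<comment> \<open>Local finiteness of both measures comes from \<open>Ap\<close>: a finite product
    of positive factors has finite factors.\<close>
  have fin: "emeasure Mv (cube a l) < \<infinity>" "emeasure Ms (cube a l) < \<infinity>" if l: "0 < l" for a l
  proof -
    have le: "emeasure Mv (cube a l) * epowr (emeasure Ms (cube a l)) (p - 1) \<le> K * epowr (emeasure lebesgue (cube a l)) p"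
      using Ap[OF cube_in_cubes[OF l]] by (simp add: Mv Ms)
    also have "\<dots> < \<infinity>" using K l emeasure_cube[of l a]
      by (simp add: ennreal_mult_less_top del: emeasure_completion)
    finally have "emeasure Mv (cube a l) * epowr (emeasure Ms (cube a l)) (p - 1) < \<infinity>" .
    moreover have "0 < epowr (emeasure Ms (cube a l)) (p - 1)"
      using pos(2)[OF l, of a] by (cases "emeasure Ms (cube a l)") auto
    ultimately show "emeasure Mv (cube a l) < \<infinity>" "emeasure Ms (cube a l) < \<infinity>"
      using pos(1)[OF l, of a]
      by (auto simp: ennreal_mult_less_top less_top[symmetric] epowr_eq_top_iff[unfolded infinity_ennreal_def])
  qed
  \<comment> \<open>The first factor pays for passing to the countable family, raised to
    \<open>p - 1\<close>; the last one for applying \<open>Ap\<close> on tripled cubes.\<close>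
  define K' where "K' = ennreal ((3 ^ CARD('n)) powr (p - 1)) * (K * ennreal ((3 ^ CARD('n)) powr p))"
  have K': "K' < \<infinity>" using K by (simp add: K'_def ennreal_mult_less_top)
  define C1 where "C1 = ennreal (q / (q - 1) * 2 powr q)"
  define C2 where "C2 = ennreal (p / (p - 1) * 2 powr p)"
  show thesis
  proof
    show "epowr K' q * (C1 * (L * C2)) < \<infinity>"
      using K' L by (auto simp: ennreal_mult_eq_top_iff C1_def C2_def less_top[symmetric] epowr_eq_top_iff[unfolded infinity_ennreal_def])
    fix f :: "real ^ 'n \<Rightarrow> real" assume f[measurable]: "f \<in> borel_measurable lebesgue"
    define h where "h x = ennreal \<bar>f x\<bar> / s x" for x
    define Ns where "Ns = dilated_maximal Ms P h"
    define G where "G x = epowr (Ns x) (p - 1) / v x" for x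
    define Nv where "Nv = dilated_maximal Mv P G"
    have [measurable]: "h \<in> borel_measurable lebesgue"
      unfolding h_def by measurable
    have "Ns \<in> borel_measurable Ms"
      unfolding Ns_def by (intro borel_measurable_dilated_maximal P sets)
    then have [measurable]: "Ns \<in> borel_measurable lebesgue" by (simp add: Ms_def)
    have [measurable]: "G \<in> borel_measurable lebesgue"
      unfolding G_def by measurable
    have "Nv \<in> borel_measurable Mv"
      unfolding Nv_def by (intro borel_measurable_dilated_maximal P sets)
    then have [measurable]: "Nv \<in> borel_measurable lebesgue" by (simp add: Mv_def)
    \<comment> \<open>Lerner's pointwise estimate. The integral of \<open>h\<close> against
      \<open>s\<close> is that of \<open>\<bar>f\<bar>\<close>, so \<open>Ns\<close> is at least
      \<open>?I / ?S\<close> on the whole cube. The integral of \<open>G\<close> against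
      \<open>v\<close> is that of \<open>Ns\<close> to the power \<open>p - 1\<close>; its quotient
      by \<open>?V\<close> is therefore bounded below by the expression in the scalar lemma, and
      \<open>Nv x\<close> dominates this quotient.\<close>
    have step: "epowr (average (cube b m) (\<lambda>y. ennreal \<bar>f y\<bar>)) (p - 1) \<le> K * ennreal ((3 ^ CARD('n)) powr p) * Nv x"
      if bm: "(b, m) \<in> P" "x \<in> cube b m" for b m x
    proof -
      have m: "0 < m" using P(2) bm by blast
      let ?I = "\<integral>\<^sup>+y\<in>cube b m. ennreal \<bar>f y\<bar> \<partial>lebesgue"
      let ?S = "emeasure Ms (tripled b m)" and ?V = "emeasure Mv (tripled b m)"
      have SV: "0 < ?S" "?S < \<infinity>" "0 < ?V" "?V < \<infinity>"
        using m pos fin by (auto simp: tripled_def)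
      have "(\<integral>\<^sup>+y\<in>cube b m. h y \<partial>Ms) = (\<integral>\<^sup>+y. s y * (h y * indicator (cube b m) y) \<partial>lebesgue)"
        unfolding Ms_def by (rule nn_integral_density) measurable
      also have "\<dots> = ?I"
      proof (intro nn_integral_cong_AE)
        show "AE y in lebesgue. s y * (h y * indicator (cube b m) y) = ennreal \<bar>f y\<bar> * indicator (cube b m) y"
          using s(2)
        proof eventually_elim
          case (elim y)
          have "s y * (ennreal \<bar>f y\<bar> / s y) = ennreal \<bar>f y\<bar>"
            using elim s(3)[of y] by (simp add: ennreal_mult_divide_cancel)
          then show ?case by (simp add: h_def mult.assoc[symmetric])
        qed
      qed
      finally have Ns_ge: "?I / ?S \<le> Ns y" if "y \<in> cube b m" for y
        using dilated_maximal_ge[OF bm(1) that, where g = h and M = Ms] by (simp add: Ns_def)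
      have "epowr (?I / ?S) (p - 1) * emeasure lebesgue (cube b m)
          = (\<integral>\<^sup>+y. epowr (?I / ?S) (p - 1) * indicator (cube b m) y \<partial>lebesgue)"
        by (simp add: nn_integral_cmult_indicator)
      also have "\<dots> \<le> (\<integral>\<^sup>+y\<in>cube b m. epowr (Ns y) (p - 1) \<partial>lebesgue)"
        using Ns_ge p by (intro nn_integral_mono) (auto simp: indicator_def intro!: epowr_mono)
      also have "\<dots> = (\<integral>\<^sup>+y. v y * (G y * indicator (cube b m) y) \<partial>lebesgue)"
      proof (intro nn_integral_cong_AE)
        show "AE y in lebesgue. epowr (Ns y) (p - 1) * indicator (cube b m) y = v y * (G y * indicator (cube b m) y)"
          using v(2)
        proof eventually_elim
          case (elim y)
          have "v y * G y = epowr (Ns y) (p - 1)"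
            using elim v(3)[of y] by (simp add: G_def ennreal_mult_divide_cancel)
          then show ?case by (simp add: mult.assoc[symmetric])
        qed
      qed
      also have "\<dots> = (\<integral>\<^sup>+y\<in>cube b m. G y \<partial>Mv)"
        unfolding Mv_def by (rule nn_integral_density[symmetric]) measurable
      finally have "epowr (?I / ?S) (p - 1) * emeasure lebesgue (cube b m) / ?V \<le> (\<integral>\<^sup>+y\<in>cube b m. G y \<partial>Mv) / ?V"
        by (rule divide_right_mono_ennreal)
      also have "\<dots> \<le> Nv x"
        unfolding Nv_def by (rule dilated_maximal_ge[OF bm])
      finally have Nv: "epowr (?I / ?S) (p - 1) * ennreal (m ^ CARD('n)) / ?V \<le> Nv x"
        using m by (simp add: emeasure_cube del: emeasure_completion)
      have "epowr (?I / ennreal (m ^ CARD('n))) (p - 1) \<le>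
        K * ennreal ((3 ^ CARD('n)) powr p) * ((epowr (?I / ?S) (p - 1) * ennreal (m ^ CARD('n))) / ?V)"
      proof (rule ennreal_power_mean_step)
        show "?V * epowr ?S (p - 1) \<le> K * epowr (ennreal (3 ^ CARD('n) * m ^ CARD('n))) p"
          using Ap[OF tripled_in_cubes[OF m, of b]] emeasure_tripled[of m b] m
          by (simp add: Mv Ms emeasure_cube ennreal_mult del: emeasure_completion)
      qed (use m p K SV in auto)
      also have "\<dots> \<le> K * ennreal ((3 ^ CARD('n)) powr p) * Nv x"
        using Nv by (intro mult_left_mono) auto
      finally show ?thesis using m by (simp add: average_def emeasure_cube del: emeasure_completion)
    qed
    have Mf_le: "maximal_function f x \<le> epowr (K' * Nv x) (1 / (p - 1))" for x
      unfolding maximal_function_def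
    proof (rule SUP_least)
      fix Q assume "Q \<in> {Q \<in> cubes. x \<in> Q}"
      then obtain a l where al: "Q = cube a l" "0 < l" "x \<in> cube a l" by (auto simp: cubes_eq)
      obtain b m where bm: "(b, m) \<in> P" "cube a l \<subseteq> cube b m" "m \<le> 3 * l" using P(3)[OF al(2)] by blast
      have "epowr (average Q (\<lambda>y. ennreal \<bar>f y\<bar>)) (p - 1)
          \<le> epowr (ennreal (3 ^ CARD('n)) * average (cube b m) (\<lambda>y. ennreal \<bar>f y\<bar>)) (p - 1)"
        unfolding al(1) using p by (intro epowr_mono average_cube_le al bm) auto
      also have "\<dots> \<le> ennreal ((3 ^ CARD('n)) powr (p - 1)) * (K * ennreal ((3 ^ CARD('n)) powr p) * Nv x)"
        unfolding epowr_mult using step[OF bm(1), of x] bm(2) al(3) by (auto intro!: mult_left_mono)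
      also have "\<dots> = K' * Nv x" by (simp add: K'_def mult_ac)
      finally show "average Q (\<lambda>y. ennreal \<bar>f y\<bar>) \<le> epowr (K' * Nv x) (1 / (p - 1))"
        using p by (simp add: epowr_le_iff)
    qed
    define H where "H x = epowr (K' * Nv x) q" for x
    have "epowr (maximal_function f x) p \<le> H x" for x
      using epowr_mono[OF Mf_le[of x], of p] p q(4) by (simp add: epowr_epowr H_def)
    moreover have [measurable]: "H \<in> borel_measurable lebesgue"
      unfolding H_def by measurable
    moreover have "(\<integral>\<^sup>+x. H x * v x \<partial>lebesgue)
        \<le> epowr K' q * (C1 * (L * C2)) * (\<integral>\<^sup>+x. epowr (ennreal \<bar>f x\<bar> / s x) p * s x \<partial>lebesgue)"
    proof -
      have "(\<integral>\<^sup>+x. H x * v x \<partial>lebesgue) = (\<integral>\<^sup>+x. H x \<partial>Mv)"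
        unfolding Mv_def by (simp add: nn_integral_density mult.commute)
      also have "\<dots> = epowr K' q * (\<integral>\<^sup>+x. epowr (Nv x) q \<partial>Mv)"
        unfolding H_def epowr_mult by (rule nn_integral_cmult) (simp add: Mv_def)
      also have "\<dots> \<le> epowr K' q * (C1 * (\<integral>\<^sup>+x. epowr (G x) q \<partial>Mv))"
        unfolding Nv_def C1_def using P sets fin q
        by (intro mult_left_mono dilated_maximal_strong_type) (auto simp: Mv_def)
      also have "(\<integral>\<^sup>+x. epowr (G x) q \<partial>Mv) = (\<integral>\<^sup>+x. v x * epowr (G x) q \<partial>lebesgue)"
        unfolding Mv_def by (simp add: nn_integral_density)
      also have "\<dots> \<le> (\<integral>\<^sup>+x. L * (s x * epowr (Ns x) p) \<partial>lebesgue)"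
      proof (intro nn_integral_mono_AE)
        show "AE x in lebesgue. v x * epowr (G x) q \<le> L * (s x * epowr (Ns x) p)"
          using v(2) vs
        proof eventually_elim
          case (elim x)
          \<comment> \<open>Uses \<open>(p - 1) * q = p\<close> for \<open>Ns\<close> and
            \<open>q = 1 + 1 / (p - 1)\<close> for \<open>v\<close>: one inverse of \<open>v\<close>
            cancels, the remaining power is what \<open>vs\<close> controls.\<close>
          have "v x * epowr (G x) q = v x * inverse (v x) * (epowr (inverse (v x)) (1 / (p - 1)) * epowr (Ns x) p)"
            by (simp add: G_def divide_ennreal_def epowr_mult epowr_epowr q(3))
              (simp add: q(2) epowr_add mult_ac)
          also have "v x * inverse (v x) = 1"
            using elim v(3)[of x] by (metis ennreal_divide_self divide_ennreal_def infinity_ennreal_def less_irrefl)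
          also have "1 * (epowr (inverse (v x)) (1 / (p - 1)) * epowr (Ns x) p) \<le> L * s x * epowr (Ns x) p"
            using elim by (auto intro!: mult_right_mono)
          finally show ?case by (simp add: mult_ac)
        qed
      qed
      also have "\<dots> = L * (\<integral>\<^sup>+x. epowr (Ns x) p \<partial>Ms)"
        unfolding Ms_def by (simp add: nn_integral_density nn_integral_cmult)
      also have "\<dots> \<le> L * (C2 * (\<integral>\<^sup>+x. epowr (h x) p \<partial>Ms))"
        unfolding Ns_def C2_def using P sets fin p
        by (intro mult_left_mono dilated_maximal_strong_type) (auto simp: Ms_def)
      also have "(\<integral>\<^sup>+x. epowr (h x) p \<partial>Ms) = (\<integral>\<^sup>+x. epowr (ennreal \<bar>f x\<bar> / s x) p * s x \<partial>lebesgue)"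
        unfolding Ms_def by (simp add: nn_integral_density h_def mult.commute)
      finally show ?thesis
        by (simp add: mult_left_mono mult.assoc)
    qed
    ultimately show "\<exists>H \<in> borel_measurable lebesgue.
      (\<forall>x. epowr (maximal_function f x) p \<le> H x) \<and>
      (\<integral>\<^sup>+x. H x * v x \<partial>lebesgue) \<le> epowr K' q * (C1 * (L * C2)) * (\<integral>\<^sup>+x. epowr (ennreal \<bar>f x\<bar> / s x) p * s x \<partial>lebesgue)"
      by blast
  qed
qed

section \<open>Linear changes of variables and weights\<close>

lemma
  fixes B :: "real ^ 'n ^ 'n"
  assumes "invertible B"
  shows matrix_inv_right: "B ** matrix_inv B = mat 1"
    and matrix_inv_left: "matrix_inv B ** B = mat 1"
  using someI_ex[OF assms[unfolded invertible_def]] by (simp_all add: matrix_inv_def)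

lemma invertible_matrix_cancel:
  fixes B :: "real ^ 'n ^ 'n"
  assumes "invertible B"
  shows "B *v (matrix_inv B *v x) = x" "matrix_inv B *v (B *v x) = x"
  using matrix_inv_right[OF assms] matrix_inv_left[OF assms]
  by (simp_all add: matrix_vector_mul_assoc)

lemma invertible_matrix_inv:
  fixes B :: "real ^ 'n ^ 'n"
  assumes "invertible B"
  shows "invertible (matrix_inv B)"
  using matrix_inv_right[OF assms] matrix_inv_left[OF assms] by (auto simp: invertible_def)

lemma vimage_matrix_vector_mult:
  fixes B :: "real ^ 'n ^ 'n"
  assumes "invertible B"
  shows "(\<lambda>x. B *v x) -` S = (\<lambda>x. matrix_inv B *v x) ` S"
  using invertible_matrix_cancel[OF assms] by (auto simp: image_iff) metis

text \<open>A preimage under \<open>B\<close> is an image under the inverse, and differentiable maps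
  of the space to itself send Lebesgue sets to Lebesgue sets.\<close>

lemma measurable_matrix_vector_mult_lebesgue:
  fixes B :: "real ^ 'n ^ 'n"
  assumes "invertible B"
  shows "(\<lambda>x. B *v x) \<in> lebesgue \<rightarrow>\<^sub>M lebesgue"
proof (rule measurableI)
  fix S :: "(real ^ 'n) set" assume S: "S \<in> sets lebesgue"
  have "(\<lambda>x. matrix_inv B *v x) ` S \<in> sets lebesgue"
    by (rule differentiable_image_in_sets_lebesgue[OF S])
      (auto intro: linear_imp_differentiable_on)
  then show "(\<lambda>x. B *v x) -` S \<inter> space lebesgue \<in> sets lebesgue"
    by (simp add: vimage_matrix_vector_mult[OF assms])
qed simp

text \<open>The pushforward of Lebesgue measure is compared with a multiple of it on cubes only, and
  the comparison lemma extends this to all sets. The constant is the volume of the preimage of the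
  unit cube, in the role of the Jacobian.\<close>

lemma nn_integral_matrix_vector_mult_le:
  fixes B :: "real ^ 'n ^ 'n"
  assumes B: "invertible B"
  obtains c where "c < \<infinity>"
    "\<And>H. H \<in> borel_measurable lebesgue \<Longrightarrow> (\<integral>\<^sup>+x. H (B *v x) \<partial>lebesgue) \<le> c * (\<integral>\<^sup>+x. H x \<partial>lebesgue)"
proof -
  define T where "T = (\<lambda>x. matrix_inv B *v x)"
  have T: "linear T" by (simp add: T_def)
  note m [measurable] = measurable_matrix_vector_mult_lebesgue[OF B]
  define c where "c = emeasure lebesgue (T ` cube 0 1)"
  have "compact (T ` cube 0 1)"
    using T by (intro compact_continuous_image) (auto simp: cube_def linear_continuous_on linear_linear)
  then have c: "c < \<infinity>" unfolding c_def
    by (metis fmeasurableD2 infinity_ennreal_def less_top lmeasurable_compact)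
  define N where "N = distr lebesgue lebesgue (\<lambda>x. B *v x)"
  define M where "M = density lebesgue (\<lambda>_ :: real ^ 'n. c)"
  have N: "emeasure N S = emeasure lebesgue (T ` S)" if "S \<in> sets lebesgue" for S
    using that by (simp add: N_def T_def emeasure_distr vimage_matrix_vector_mult[OF B] del: emeasure_completion)
  have M: "emeasure M S = c * emeasure lebesgue S" if "S \<in> sets lebesgue" for S
    using that by (simp add: M_def emeasure_density nn_integral_cmult_indicator del: emeasure_completion)
  have le: "emeasure N S \<le> emeasure M S" if "S \<in> sets lebesgue" for S
  proof (rule emeasure_le_if_le_on_cubes)
    show "null_sets lebesgue \<subseteq> null_sets M"
      using absolutely_continuousI_density[of "\<lambda>_. c" lebesgue]
      by (simp add: M_def absolutely_continuous_def)
    fix a :: "real ^ 'n" and l :: real assume l: "0 < l"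
    \<comment> \<open>By linearity of \<open>T\<close> the image of any cube is a scaled translate
      of the image of the unit cube, which gives its volume.\<close>
    have "cube a l = (\<lambda>x. l *\<^sub>R x + a) ` cube 0 1"
    proof (intro set_eqI iffI)
      fix x assume "x \<in> cube a l"
      then have "(1 / l) *\<^sub>R (x - a) \<in> cube 0 1"
        using l by (auto simp: mem_cube field_simps)
      moreover have "x = l *\<^sub>R ((1 / l) *\<^sub>R (x - a)) + a" using l by simp
      ultimately show "x \<in> (\<lambda>x. l *\<^sub>R x + a) ` cube 0 1" by blast
    next
      fix x assume "x \<in> (\<lambda>x. l *\<^sub>R x + a) ` cube 0 1"
      then show "x \<in> cube a l" using l
        by (auto simp: mem_cube mult_left_le)
    qed
    then have "T ` cube a l = (\<lambda>x. l *\<^sub>R x + T a) ` (T ` cube 0 1)"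
      using T by (simp add: image_image linear_add linear_scale)
    then have "emeasure lebesgue (T ` cube a l) = \<bar>l\<bar> ^ DIM(real ^ 'n) * c"
      by (simp only: emeasure_lebesgue_affine c_def)
    also have "\<dots> = c * emeasure lebesgue (cube a l)"
      using l by (simp add: emeasure_cube mult.commute ennreal_power del: emeasure_completion)
    finally show "emeasure N (cube a l) \<le> emeasure M (cube a l)"
      by (simp add: N M)
    show "emeasure M (cube a l) < \<infinity>"
      using c l by (simp add: M emeasure_cube ennreal_mult_less_top del: emeasure_completion)
  qed (use that in \<open>auto simp: M_def N_def\<close>)
  have "N \<le> M"
    unfolding le_measure_iff using le by (auto simp: N_def M_def le_fun_def emeasure_notin_sets)
      (metis emeasure_notin_sets sets_density sets_distr zero_le)
  show thesis
  proof
    show "c < \<infinity>" by fact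
    fix H :: "real ^ 'n \<Rightarrow> ennreal" assume [measurable]: "H \<in> borel_measurable lebesgue"
    have "(\<integral>\<^sup>+x. H (B *v x) \<partial>lebesgue) = (\<integral>\<^sup>+x. H x \<partial>N)"
      unfolding N_def by (simp add: nn_integral_distr)
    also have "\<dots> \<le> (\<integral>\<^sup>+x. H x \<partial>M)"
      by (rule nn_integral_mono_measure) (use \<open>N \<le> M\<close> in \<open>auto simp: N_def M_def\<close>)
    also have "\<dots> = c * (\<integral>\<^sup>+x. H x \<partial>lebesgue)"
      unfolding M_def by (simp add: nn_integral_density nn_integral_cmult)
    finally show "(\<integral>\<^sup>+x. H (B *v x) \<partial>lebesgue) \<le> c * (\<integral>\<^sup>+x. H x \<partial>lebesgue)" .
  qed
qed

text \<open>The integral bound, applied to the indicator of a null set, shows that its preimage is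
  null.\<close>

lemma AE_matrix_vector_mult:
  fixes B :: "real ^ 'n ^ 'n"
  assumes B: "invertible B" and P: "AE x in lebesgue. P x"
  shows "AE x in lebesgue. P (B *v x)"
proof -
  from P obtain N where N: "{x \<in> space lebesgue. \<not> P x} \<subseteq> N" "N \<in> null_sets lebesgue"
    by (auto simp: eventually_ae_filter)
  obtain c where c: "c < \<infinity>"
    "\<And>H. H \<in> borel_measurable lebesgue \<Longrightarrow> (\<integral>\<^sup>+x. H (B *v x) \<partial>lebesgue) \<le> c * (\<integral>\<^sup>+x. H x \<partial>lebesgue)"
    using nn_integral_matrix_vector_mult_le[OF B] by blast
  note m [measurable] = measurable_matrix_vector_mult_lebesgue[OF B]
  have [measurable]: "N \<in> sets lebesgue" using N by auto
  have "(\<integral>\<^sup>+x. indicator N (B *v x) \<partial>lebesgue) \<le> c * (\<integral>\<^sup>+x. indicator N x \<partial>lebesgue)"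
    by (rule c(2)) measurable
  also have "\<dots> = 0" using null_setsD1[OF N(2)] by (simp del: emeasure_completion)
  finally have "(\<integral>\<^sup>+x. indicator N (B *v x) \<partial>lebesgue) = 0" by simp
  then have "AE x in lebesgue. (indicator N (B *v x) :: ennreal) = 0"
    by (subst (asm) nn_integral_0_iff_AE) auto
  then show ?thesis
    by eventually_elim (use N(1) in \<open>auto simp: indicator_def split: if_splits\<close>)
qed

section \<open>Weights, and Jensen's inequality for a weight and its dual\<close>

lemma weight_borel_measurable:
  fixes w :: "real ^ 'n \<Rightarrow> real"
  assumes "weight w"
  shows "w \<in> borel_measurable lebesgue"
proof (rule borel_measurable_LIMSEQ_real)
  fix n
  have "w absolutely_integrable_on central_cube n"
    using assms by (auto simp: weight_def central_cube_def cube_def)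
  then show "(\<lambda>x. indicator (central_cube n) x *\<^sub>R w x) \<in> borel_measurable lebesgue"
    by (simp add: set_integrable_def)
next
  fix x :: "real ^ 'n"
  obtain n where "x \<in> central_cube n" using UN_central_cube by blast
  then have "x \<in> central_cube m" if "n \<le> m" for m
    using incseq_central_cube that by (auto simp: incseq_def)
  then show "(\<lambda>n. indicator (central_cube n) x *\<^sub>R w x) \<longlonglongrightarrow> w x"
    by (intro tendsto_eventually) (auto simp: eventually_sequentially intro!: exI[of _ n])
qed

lemma weight_cube_finite:
  fixes w :: "real ^ 'n \<Rightarrow> real"
  assumes "weight w"
  shows "(\<integral>\<^sup>+x\<in>cube a l. ennreal (w x) \<partial>lebesgue) < \<infinity>"
proof -
  have "w absolutely_integrable_on cube a l"
    using assms by (auto simp: weight_def cube_def)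
  then have "(\<integral>\<^sup>+x. ennreal (norm (indicator (cube a l) x *\<^sub>R w x)) \<partial>lebesgue) < \<infinity>"
    by (simp add: set_integrable_def integrable_iff_bounded)
  moreover have "(\<integral>\<^sup>+x\<in>cube a l. ennreal (w x) \<partial>lebesgue) \<le> (\<integral>\<^sup>+x. ennreal (norm (indicator (cube a l) x *\<^sub>R w x)) \<partial>lebesgue)"
    by (intro nn_integral_mono) (auto simp: indicator_def intro!: ennreal_leI)
  ultimately show ?thesis by order
qed

text \<open>The convex function \<open>u powr (- b)\<close> lies above its tangent at
  \<open>u = 1\<close>.\<close>

lemma powr_neg_tangent:
  fixes u b :: real
  assumes "0 < u" "0 \<le> b"
  shows "1 + b \<le> u powr (- b) + b * u"
proof -
  have "1 - b * ln u \<le> u powr (- b)"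
    using exp_ge_add_one_self[of "- b * ln u"] assms by (simp add: powr_def)
  moreover have "b * ln u \<le> b * (u - 1)"
    using assms ln_le_minus_one[of u] by (intro mult_left_mono) auto
  ultimately show ?thesis by (simp add: algebra_simps)
qed

text \<open>Jensen's inequality by integrating a tangent line: apply the tangent bound to
  \<open>w x / m\<close> with \<open>m\<close> the mean of \<open>w\<close> over \<open>Q\<close>.
  The linear terms cancel and the dual integral is at least \<open>m powr (- b)\<close> times the
  measure of \<open>Q\<close>; raise this to the power \<open>p - 1\<close>.\<close>

lemma emeasure_powr_le_dual_weights:
  fixes w :: "'a \<Rightarrow> real"
  assumes p: "1 < p" and [measurable]: "w \<in> borel_measurable M" "Q \<in> sets M"
    and w: "AE x in M. 0 < w x"
    and Q: "0 < emeasure M Q" "emeasure M Q < \<infinity>" and fin: "(\<integral>\<^sup>+x\<in>Q. ennreal (w x) \<partial>M) < \<infinity>"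
  shows "epowr (emeasure M Q) p \<le> (\<integral>\<^sup>+x\<in>Q. ennreal (w x) \<partial>M) *
    epowr (\<integral>\<^sup>+x\<in>Q. ennreal (w x powr (- 1 / (p - 1))) \<partial>M) (p - 1)"
proof -
  define b where "b = 1 / (p - 1)"
  have b: "0 < b" "- 1 / (p - 1) = - b" "b * (p - 1) = 1" using p by (auto simp: b_def)
  have "0 < (\<integral>\<^sup>+x\<in>Q. ennreal (w x) \<partial>M)"
    using w Q by (intro set_nn_integral_pos) auto
  with fin obtain W where W: "(\<integral>\<^sup>+x\<in>Q. ennreal (w x) \<partial>M) = ennreal W" "0 < W"
    by (cases "\<integral>\<^sup>+x\<in>Q. ennreal (w x) \<partial>M") auto
  obtain c where c: "emeasure M Q = ennreal c" "0 < c" using Q by (cases "emeasure M Q") auto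
  define m where "m = W / c"
  have m: "0 < m" using W c by (simp add: m_def)
  let ?S = "\<integral>\<^sup>+x\<in>Q. ennreal (w x powr (- b)) \<partial>M"
  \<comment> \<open>The slope of the tangent after rescaling by \<open>m\<close>. Since
    \<open>W = m * c\<close>, its integral \<open>d * W\<close> equals the term
    \<open>b * m powr (- b) * c\<close> on the left.\<close>
  define d where "d = b * m powr (- b) / m"
  have d: "0 \<le> d" using b m by (simp add: d_def)
  have "ennreal ((1 + b) * m powr (- b) * c) = (\<integral>\<^sup>+x. ennreal ((1 + b) * m powr (- b)) * indicator Q x \<partial>M)"
    using c b by (simp add: nn_integral_cmult_indicator ennreal_mult)
  also have "\<dots> \<le> (\<integral>\<^sup>+x. ennreal (w x powr (- b)) * indicator Q x + ennreal d * (ennreal (w x) * indicator Q x) \<partial>M)"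
  proof (rule nn_integral_mono_AE)
    show "AE x in M. ennreal ((1 + b) * m powr (- b)) * indicator Q x
        \<le> ennreal (w x powr (- b)) * indicator Q x + ennreal d * (ennreal (w x) * indicator Q x)"
      using w
    proof eventually_elim
      case (elim x)
      have "(1 + b) * m powr (- b) \<le> ((w x / m) powr (- b) + b * (w x / m)) * m powr (- b)"
        using powr_neg_tangent[of "w x / m" b] elim m b by (intro mult_right_mono) auto
      also have "\<dots> = w x powr (- b) + d * w x"
        using elim m by (simp add: powr_divide d_def field_simps)
      finally have "ennreal ((1 + b) * m powr (- b)) \<le> ennreal (w x powr (- b)) + ennreal d * ennreal (w x)"
        using d elim by (simp add: ennreal_mult[symmetric] ennreal_plus[symmetric] ennreal_leI del: ennreal_plus)
      then show ?case by (auto simp: indicator_def)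
    qed
  qed
  also have "\<dots> = ?S + ennreal (d * W)"
    using d W by (simp add: nn_integral_add nn_integral_cmult ennreal_mult)
  finally have le: "ennreal ((1 + b) * m powr (- b) * c) \<le> ?S + ennreal (d * W)" .
  have "d * W = b * m powr (- b) * c" using W c by (simp add: d_def m_def)
  then have eq: "(1 + b) * m powr (- b) * c = m powr (- b) * c + d * W" by (simp add: algebra_simps)
  have "ennreal (m powr (- b) * c) \<le> ?S"
  proof (cases "?S")
    case (real r)
    then show ?thesis using le d W unfolding eq by (simp add: ennreal_plus[symmetric] del: ennreal_plus)
  qed simp
  then have "epowr (ennreal (m powr (- b) * c)) (p - 1) \<le> epowr ?S (p - 1)"
    using p by (intro epowr_mono) auto
  moreover have "ennreal W * epowr (ennreal (m powr (- b) * c)) (p - 1) = epowr (emeasure M Q) p"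
  proof -
    have "W * (m powr (- b) * c) powr (p - 1) = W * (m powr (- (b * (p - 1))) * c powr (p - 1))"
      using c by (simp add: powr_mult powr_powr)
    also have "\<dots> = c powr p"
      using c W unfolding b(3) by (simp add: m_def powr_minus powr_diff field_simps)
    finally show ?thesis using c W by (simp add: ennreal_mult[symmetric])
  qed
  ultimately show ?thesis
    unfolding b(2) W(1) by (metis mult_left_mono zero_le)
qed

section \<open>Maximal operators twisted by a matrix of finite order\<close>

text \<open>Clears the denominators in the class condition: the volume occurs with the exponents 1
  and \<open>p - 1\<close>, which add up to \<open>p\<close>.\<close>

lemma average_mult_epowr:
  fixes Q :: "(real ^ 'n) set"
  assumes "Q \<in> cubes"
  shows "(\<integral>\<^sup>+x\<in>Q. u x \<partial>lebesgue) * epowr (\<integral>\<^sup>+x\<in>Q. s x \<partial>lebesgue) (p - 1)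
    = average Q u * epowr (average Q s) (p - 1) * epowr (emeasure lebesgue Q) p"
proof -
  obtain c where c: "emeasure lebesgue Q = ennreal c" "0 < c"
    using assms by (auto simp: cubes_eq emeasure_cube simp del: emeasure_completion intro!: that)
  have "(\<integral>\<^sup>+x\<in>Q. g x \<partial>lebesgue) = average Q g * ennreal c" for g
    unfolding average_def c using c(2)
    by (simp add: divide_ennreal_def inverse_ennreal mult.assoc ennreal_mult[symmetric])
  moreover have "ennreal c * epowr (ennreal c) (p - 1) = epowr (ennreal c) p"
    using c(2) by (simp add: ennreal_mult[symmetric] powr_diff)
  ultimately show ?thesis
    by (simp add: c epowr_mult) (metis (no_types, lifting) mult.assoc mult.left_commute)
qed

text \<open>On each cube the class condition bounds \<open>?V * ?E\<close> by a multiple of a power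
  of the volume, and Jensen bounds that power by \<open>?W * ?E\<close>. Cancelling the dual factor
  \<open>?E\<close> compares the two integrals on every cube, hence the functions almost
  everywhere.\<close>

lemma weight_le_of_A_class:
  fixes A :: "real ^ 'n ^ 'n" and w :: "real ^ 'n \<Rightarrow> real"
  assumes p: "1 < p" and A: "invertible A" and w: "weight w" and K: "A_constant A p w < \<infinity>"
  shows "AE x in lebesgue. ennreal (w (A *v x)) \<le> A_constant A p w * ennreal (w x)"
proof -
  let ?K = "A_constant A p w"
  note wm [measurable] = weight_borel_measurable[OF w]
  note Am [measurable] = measurable_matrix_vector_mult_lebesgue[OF A]
  have pos: "AE x in lebesgue. 0 < w x" using w by (simp add: weight_def)
  have posA: "AE x in lebesgue. 0 < w (A *v x)" by (rule AE_matrix_vector_mult[OF A pos])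
  show ?thesis
  proof (rule AE_le_if_le_on_cubes)
    show "(\<lambda>x. ennreal (w (A *v x))) \<in> borel_measurable lebesgue"
      "(\<lambda>x. ?K * ennreal (w x)) \<in> borel_measurable lebesgue" by measurable
    fix a :: "real ^ 'n" and l :: real assume l: "0 < l"
    let ?Q = "cube a l"
    let ?V = "\<integral>\<^sup>+x\<in>?Q. ennreal (w (A *v x)) \<partial>lebesgue" and ?W = "\<integral>\<^sup>+x\<in>?Q. ennreal (w x) \<partial>lebesgue"
    let ?E = "epowr (\<integral>\<^sup>+x\<in>?Q. ennreal (w x powr (- 1 / (p - 1))) \<partial>lebesgue) (p - 1)"
    have Q: "?Q \<in> cubes" using l by (rule cube_in_cubes)
    have c: "0 < emeasure lebesgue ?Q" "emeasure lebesgue ?Q < \<infinity>"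
      using l by (simp_all add: emeasure_cube del: emeasure_completion)
    have eq: "(\<integral>\<^sup>+x\<in>?Q. (?K * ennreal (w x)) \<partial>lebesgue) = ?K * ?W"
      by (simp add: mult.assoc nn_integral_cmult)
    have W: "?W < \<infinity>" by (rule weight_cube_finite[OF w])
    then show "(\<integral>\<^sup>+x\<in>?Q. (?K * ennreal (w x)) \<partial>lebesgue) < \<infinity>"
      unfolding eq using K by (simp add: ennreal_mult_less_top)
    have "?V * ?E \<le> ?K * epowr (emeasure lebesgue ?Q) p"
      unfolding average_mult_epowr[OF Q] A_constant_def by (intro mult_right_mono SUP_upper Q) auto
    also have "\<dots> \<le> ?K * (?W * ?E)"
      using p pos c W by (intro mult_left_mono emeasure_powr_le_dual_weights) auto
    finally have le: "?V * ?E \<le> ?K * ?W * ?E" by (simp add: mult.assoc)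
    have "?V * ?E < \<infinity>"
    proof -
      have "?V * ?E \<le> ?K * epowr (emeasure lebesgue ?Q) p" by fact
      also have "\<dots> < \<infinity>"
        using K l by (simp add: emeasure_cube ennreal_mult_less_top del: emeasure_completion)
      finally show ?thesis .
    qed
    moreover have "0 < ?V"
      using posA c by (intro set_nn_integral_pos) auto
    \<comment> \<open>Cancellation needs \<open>?E\<close> finite and nonzero. Finiteness follows
      from the bound on the product because \<open>?V\<close> is positive.\<close>
    ultimately have E: "?E < \<infinity>"
      by (auto simp: ennreal_mult_less_top)
    have "0 < (\<integral>\<^sup>+x\<in>?Q. ennreal (w x powr (- 1 / (p - 1))) \<partial>lebesgue)"
    proof (rule set_nn_integral_pos)
      show "AE x in lebesgue. 0 < ennreal (w x powr (- 1 / (p - 1)))"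
        using pos by eventually_elim simp
    qed (use c in auto)
    then have "0 < ?E"
      by (cases "\<integral>\<^sup>+x\<in>?Q. ennreal (w x powr (- 1 / (p - 1))) \<partial>lebesgue") auto
    then have "?E \<noteq> 0" "?E \<noteq> top" using E by auto
    moreover have "?E * ?V \<le> ?E * (?K * ?W)"
      using le by (simp only: mult.commute[of ?E])
    ultimately show "?V \<le> (\<integral>\<^sup>+x\<in>?Q. (?K * ennreal (w x)) \<partial>lebesgue)"
      unfolding eq by (rule ennreal_mult_le_mult_iff[THEN iffD1])
  qed
qed

lemma matrix_pow_funpow: "matrix_pow A j *v x = ((\<lambda>x. A *v x) ^^ j) x"
  by (induction j) (simp_all add: matrix_vector_mul_assoc[symmetric])

text \<open>
  Since \<open>A\<close> has finite order, the pointwise inequality between \<open>w \<circ> A\<close> and \<open>w\<close> can be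
  iterated around the cycle, which reverses it.
\<close>

lemma weight_comparable_of_A_class:
  fixes A :: "real ^ 'n ^ 'n" and w :: "real ^ 'n \<Rightarrow> real"
  assumes p: "1 < p" and A: "invertible A" and k: "0 < k" "matrix_pow A k = mat 1"
    and w: "weight w" and K: "A_constant A p w < \<infinity>"
  shows "\<exists>c>0. AE x in lebesgue. w x \<le> c * w (A *v x)"
proof -
  define F where "F = (\<lambda>x. A *v x)"
  obtain K' where K': "A_constant A p w = ennreal K'" "0 \<le> K'"
    using K by (cases "A_constant A p w") auto
  have pos: "AE x in lebesgue. 0 < w x" using w by (simp add: weight_def)
  have le: "AE x in lebesgue. w (F x) \<le> K' * w x"
    using weight_le_of_A_class[OF p A w K] pos AE_matrix_vector_mult[OF A pos]
    by eventually_elim (simp add: K' F_def ennreal_mult[symmetric])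
  have iter: "AE x in lebesgue. w ((F ^^ j) x) \<le> K' ^ j * w x" for j
  proof (induction j)
    case (Suc j)
    have "AE x in lebesgue. w ((F ^^ j) (F x)) \<le> K' ^ j * w (F x)"
      using AE_matrix_vector_mult[OF A Suc] by (simp add: F_def)
    then show ?case using le
    proof eventually_elim
      case (elim x)
      have "w ((F ^^ Suc j) x) \<le> K' ^ j * w (F x)"
        using elim by (simp add: funpow_Suc_right del: funpow.simps)
      also have "\<dots> \<le> K' ^ j * (K' * w x)" using elim K'(2) by (intro mult_left_mono) auto
      finally show ?case by (simp add: mult_ac)
    qed
  qed simp
  obtain j where j: "k = Suc j" using k(1) by (cases k) auto
  have "AE x in lebesgue. w ((F ^^ j) (F x)) \<le> K' ^ j * w (F x)"
    using AE_matrix_vector_mult[OF A iter[of j]] by (simp add: F_def)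
  then have "AE x in lebesgue. w x \<le> K' ^ j * w (F x)"
  proof eventually_elim
    case (elim x)
    \<comment> \<open>After the first step from \<open>x\<close> to \<open>F x\<close>, the
      remaining \<open>k - 1\<close> steps of the cycle lead back to \<open>x\<close>.\<close>
    have "(F ^^ j) (F x) = matrix_pow A k *v x"
      by (simp only: matrix_pow_funpow j F_def funpow_Suc_right comp_apply)
    with elim show ?case using k(2) by simp
  qed
  \<comment> \<open>Adding 1 makes the constant strictly positive.\<close>
  then have "AE x in lebesgue. w x \<le> (K' ^ j + 1) * w (A *v x)"
    using AE_matrix_vector_mult[OF A pos] by eventually_elim (simp add: F_def algebra_simps)
  then show ?thesis using K'(2) by (intro exI[of _ "K' ^ j + 1"]) (auto intro: add_nonneg_pos)
qed

text \<open>The two-weight bound for \<open>v = w \<circ> A\<close> and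
  \<open>s = w powr (- b)\<close>; substituting \<open>matrix_inv A *v x\<close> turns
  \<open>v\<close> back into \<open>w\<close> and the maximal function into its twisted
  form.\<close>

lemma maximal_bound_of_A_class:
  fixes A :: "real ^ 'n ^ 'n" and w :: "real ^ 'n \<Rightarrow> real"
  assumes p: "1 < p" and A: "invertible A" and k: "0 < k" "matrix_pow A k = mat 1"
    and w: "weight w" and K: "A_constant A p w < \<infinity>"
  shows "\<exists>C::real. \<forall>f \<in> borel_measurable lebesgue.
       (\<integral>\<^sup>+x. epowr (maximal_function_inv A f x) p * ennreal (w x) \<partial>lebesgue)
         \<le> ennreal C * (\<integral>\<^sup>+x. ennreal (\<bar>f x\<bar> powr p) * ennreal (w x) \<partial>lebesgue)"
proof -
  note wm [measurable] = weight_borel_measurable[OF w]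
  note Am [measurable] = measurable_matrix_vector_mult_lebesgue[OF A]
  note Bm [measurable] = measurable_matrix_vector_mult_lebesgue[OF invertible_matrix_inv[OF A]]
  have pos: "AE x in lebesgue. 0 < w x" using w by (simp add: weight_def)
  have posA: "AE x in lebesgue. 0 < w (A *v x)" by (rule AE_matrix_vector_mult[OF A pos])
  define b where "b = 1 / (p - 1)"
  have b: "0 < b" "- 1 / (p - 1) = - b" "b * p = b + 1" using p by (auto simp: b_def field_simps)
  define v where "v x = ennreal (w (A *v x))" for x
  define s where "s x = ennreal (w x powr (- b))" for x
  obtain c where c: "0 < c" "AE x in lebesgue. w x \<le> c * w (A *v x)"
    using weight_comparable_of_A_class[OF assms] by blast
  obtain C where C: "C < \<infinity>"
    "\<And>f. f \<in> borel_measurable lebesgue \<Longrightarrow> \<exists>H \<in> borel_measurable lebesgue.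
      (\<forall>x. epowr (maximal_function f x) p \<le> H x) \<and>
      (\<integral>\<^sup>+x. H x * v x \<partial>lebesgue) \<le> C * (\<integral>\<^sup>+x. epowr (ennreal \<bar>f x\<bar> / s x) p * s x \<partial>lebesgue)"
  proof (rule two_weight_maximal_bound[of p "A_constant A p w" "ennreal (c powr b)" v s])
    show "1 < p" "A_constant A p w < \<infinity>" "ennreal (c powr b) < \<infinity>" using p K by auto
    show "v \<in> borel_measurable lebesgue" "s \<in> borel_measurable lebesgue"
      unfolding v_def s_def by measurable
    show "AE x in lebesgue. 0 < v x" using posA by eventually_elim (simp add: v_def)
    show "AE x in lebesgue. 0 < s x" using pos by eventually_elim (simp add: s_def)
    show "v x < \<infinity>" "s x < \<infinity>" for x by (simp_all add: v_def s_def)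
    show "(\<integral>\<^sup>+x\<in>Q. v x \<partial>lebesgue) * epowr (\<integral>\<^sup>+x\<in>Q. s x \<partial>lebesgue) (p - 1)
        \<le> A_constant A p w * epowr (emeasure lebesgue Q) p" if Q: "Q \<in> cubes" for Q
      unfolding average_mult_epowr[OF Q] A_constant_def v_def s_def b(2)
      by (intro mult_right_mono SUP_upper Q) auto
    \<comment> \<open>The only place where the reversed comparison, and with it the finite order of
      \<open>A\<close>, is used.\<close>
    show "AE x in lebesgue. epowr (inverse (v x)) (1 / (p - 1)) \<le> ennreal (c powr b) * s x"
      using pos posA c(2)
    proof eventually_elim
      case (elim x)
      have "inverse (w (A *v x)) \<le> c * inverse (w x)"
        using elim c(1) by (simp add: field_simps)
      then have "inverse (w (A *v x)) powr b \<le> (c * inverse (w x)) powr b"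
        using elim b by (intro powr_mono2) auto
      also have "\<dots> = c powr b * w x powr (- b)"
        using elim c(1) by (simp add: powr_mult powr_minus inverse_powr)
      finally have "ennreal (inverse (w (A *v x)) powr b) \<le> ennreal (c powr b * w x powr (- b))"
        by (rule ennreal_leI)
      then show ?case
        using elim by (simp add: v_def s_def inverse_ennreal b_def[symmetric] ennreal_mult)
    qed
  qed blast
  obtain d where d: "d < \<infinity>"
    "\<And>H. H \<in> borel_measurable lebesgue \<Longrightarrow> (\<integral>\<^sup>+x. H (matrix_inv A *v x) \<partial>lebesgue) \<le> d * (\<integral>\<^sup>+x. H x \<partial>lebesgue)"
    using nn_integral_matrix_vector_mult_le[OF invertible_matrix_inv[OF A]] by blast
  obtain C' where C': "d * C = ennreal C'"
    using C(1) d(1) by (cases "d * C") (auto simp: ennreal_mult_eq_top_iff)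
  show ?thesis
  proof (intro exI[of _ C'] ballI)
    fix f :: "real ^ 'n \<Rightarrow> real" assume f[measurable]: "f \<in> borel_measurable lebesgue"
    obtain H where [measurable]: "H \<in> borel_measurable lebesgue"
      and H: "\<And>x. epowr (maximal_function f x) p \<le> H x"
        "(\<integral>\<^sup>+x. H x * v x \<partial>lebesgue) \<le> C * (\<integral>\<^sup>+x. epowr (ennreal \<bar>f x\<bar> / s x) p * s x \<partial>lebesgue)"
      using C(2)[OF f] by blast
    have [measurable]: "v \<in> borel_measurable lebesgue"
      unfolding v_def by measurable
    have "(\<integral>\<^sup>+x. epowr (maximal_function_inv A f x) p * ennreal (w x) \<partial>lebesgue)
        \<le> (\<integral>\<^sup>+x. H (matrix_inv A *v x) * v (matrix_inv A *v x) \<partial>lebesgue)"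
      by (intro nn_integral_mono)
        (auto simp: maximal_function_inv_def v_def invertible_matrix_cancel[OF A] intro!: mult_right_mono H(1))
    also have "\<dots> \<le> d * (\<integral>\<^sup>+x. H x * v x \<partial>lebesgue)"
      using d(2)[of "\<lambda>x. H x * v x"] by simp
    also have "\<dots> \<le> d * (C * (\<integral>\<^sup>+x. epowr (ennreal \<bar>f x\<bar> / s x) p * s x \<partial>lebesgue))"
      using H(2) by (rule mult_left_mono) simp
    also have "(\<integral>\<^sup>+x. epowr (ennreal \<bar>f x\<bar> / s x) p * s x \<partial>lebesgue)
        = (\<integral>\<^sup>+x. ennreal (\<bar>f x\<bar> powr p) * ennreal (w x) \<partial>lebesgue)"
    proof (rule nn_integral_cong_AE)
      show "AE x in lebesgue. epowr (ennreal \<bar>f x\<bar> / s x) p * s x = ennreal (\<bar>f x\<bar> powr p) * ennreal (w x)"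
        using pos
      proof eventually_elim
        case (elim x)
        \<comment> \<open>The powers of \<open>w\<close> combine to \<open>w\<close> itself because
          \<open>b * p = b + 1\<close>.\<close>
        have "(\<bar>f x\<bar> / w x powr (- b)) powr p * w x powr (- b) = \<bar>f x\<bar> powr p * (w x powr (b * p) * w x powr (- b))"
          using elim by (simp add: powr_mult powr_powr powr_minus divide_inverse)
        also have "w x powr (b * p) * w x powr (- b) = w x"
          using elim unfolding powr_add[symmetric] b(3) by simp
        finally show ?case
          using elim by (simp add: s_def divide_ennreal ennreal_mult[symmetric])
      qed
    qed
    finally show "(\<integral>\<^sup>+x. epowr (maximal_function_inv A f x) p * ennreal (w x) \<partial>lebesgue)
         \<le> ennreal C' * (\<integral>\<^sup>+x. ennreal (\<bar>f x\<bar> powr p) * ennreal (w x) \<partial>lebesgue)"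
      by (simp only: C'[symmetric] mult.assoc)
  qed
qed

text \<open>Testing on the dual weight cut to a cube; its regularisation by
  \<open>\<epsilon>\<close> ensures a finite norm, so that the common factor on both sides may be
  cancelled.\<close>

lemma A_constant_finite_of_maximal_bound:
  fixes A :: "real ^ 'n ^ 'n" and w :: "real ^ 'n \<Rightarrow> real" and C :: real
  assumes p: "1 < p" and A: "invertible A" and w: "weight w"
    and bound: "\<And>f. f \<in> weighted_Lp p w \<Longrightarrow>
       (\<integral>\<^sup>+x. epowr (maximal_function_inv A f x) p * ennreal (w x) \<partial>lebesgue)
         \<le> ennreal C * (\<integral>\<^sup>+x. ennreal (\<bar>f x\<bar> powr p) * ennreal (w x) \<partial>lebesgue)"
  shows "A_constant A p w < \<infinity>"
proof -
  note wm [measurable] = weight_borel_measurable[OF w]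
  note Am [measurable] = measurable_matrix_vector_mult_lebesgue[OF A]
  note Bm [measurable] = measurable_matrix_vector_mult_lebesgue[OF invertible_matrix_inv[OF A]]
  have pos: "AE x in lebesgue. 0 < w x" using w by (simp add: weight_def)
  have posA: "AE x in lebesgue. 0 < w (A *v x)" by (rule AE_matrix_vector_mult[OF A pos])
  define b where "b = 1 / (p - 1)"
  have b: "0 < b" "- 1 / (p - 1) = - b" "b * p = b + 1" using p by (auto simp: b_def field_simps)
  obtain d where d: "d < \<infinity>"
    "\<And>H. H \<in> borel_measurable lebesgue \<Longrightarrow> (\<integral>\<^sup>+x. H (A *v x) \<partial>lebesgue) \<le> d * (\<integral>\<^sup>+x. H x \<partial>lebesgue)"
    using nn_integral_matrix_vector_mult_le[OF A] by blast
  define D where "D = d * ennreal C"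
  have D: "D < \<infinity>" using d by (simp add: D_def ennreal_mult_less_top)
  have cube_bound: "average Q (\<lambda>x. ennreal (w (A *v x))) *
      epowr (average Q (\<lambda>x. ennreal (w x powr (- 1 / (p - 1))))) (p - 1) \<le> D" if Q: "Q \<in> cubes" for Q
  proof -
    obtain c where c: "emeasure lebesgue Q = ennreal c" "0 < c"
      using Q by (auto simp: cubes_eq emeasure_cube simp del: emeasure_completion intro!: that)
    have [measurable]: "Q \<in> sets lebesgue" using Q by (auto simp: cubes_eq)
    have average: "average Q g = (\<integral>\<^sup>+x\<in>Q. g x \<partial>lebesgue) * ennreal (inverse c)" for g
      using c(2) by (simp add: average_def c(1) divide_ennreal_def inverse_ennreal del: emeasure_completion)
    define V where "V = average Q (\<lambda>x. ennreal (w (A *v x)))"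
    \<comment> \<open>The absolute value keeps the base at least \<open>\<epsilon>\<close> at every
      point, also on the null set where \<open>w\<close> may be negative, so
      \<open>\<sigma> \<epsilon>\<close> is bounded.\<close>
    define \<sigma> where "\<sigma> \<epsilon> x = (\<bar>w x\<bar> + \<epsilon>) powr (- b)" for \<epsilon> x
    define m where "m \<epsilon> = average Q (\<lambda>x. ennreal (\<sigma> \<epsilon> x))" for \<epsilon>
    have [measurable]: "\<sigma> \<epsilon> \<in> borel_measurable lebesgue" for \<epsilon>
      unfolding \<sigma>_def by measurable
    have V0: "0 < V"
    proof -
      have "0 < (\<integral>\<^sup>+x\<in>Q. ennreal (w (A *v x)) \<partial>lebesgue)"
        using posA c by (intro set_nn_integral_pos) auto
      then show ?thesis using c(2) by (simp add: V_def average ennreal_zero_less_mult_iff)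
    qed
    have eps: "V * epowr (m \<epsilon>) (p - 1) \<le> D \<and> 0 < m \<epsilon>" if \<epsilon>: "0 < \<epsilon>" for \<epsilon>
    proof -
      define f where "f x = indicator Q x * \<sigma> \<epsilon> x" for x
      have f [measurable]: "f \<in> borel_measurable lebesgue" unfolding f_def by measurable
      have I: "(\<integral>\<^sup>+x\<in>Q. ennreal (\<sigma> \<epsilon> x) \<partial>lebesgue) = m \<epsilon> * ennreal c"
        using c(2) by (simp add: m_def average mult.assoc ennreal_mult[symmetric])
      have "(\<integral>\<^sup>+x\<in>Q. ennreal (\<sigma> \<epsilon> x) \<partial>lebesgue) \<le> (\<integral>\<^sup>+x. ennreal (\<epsilon> powr (- b)) * indicator Q x \<partial>lebesgue)"
        using b \<epsilon> by (intro nn_integral_mono mult_right_mono ennreal_leI)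
          (auto simp: \<sigma>_def intro!: powr_mono2')
      also have "\<dots> < \<infinity>"
        using c by (simp add: nn_integral_cmult_indicator ennreal_mult_less_top del: emeasure_completion)
      finally have fin: "m \<epsilon> * ennreal c < \<infinity>" by (simp add: I)
      then have m_fin: "m \<epsilon> < \<infinity>" using c(2) by (auto simp: ennreal_mult_less_top)
      have "0 < (\<integral>\<^sup>+x\<in>Q. ennreal (\<sigma> \<epsilon> x) \<partial>lebesgue)"
        using c \<epsilon> by (intro set_nn_integral_pos) (auto simp: \<sigma>_def add_nonneg_pos intro!: AE_I2)
      then have m0: "0 < m \<epsilon>" using I by (auto simp: ennreal_zero_less_mult_iff)
      \<comment> \<open>On \<open>Q\<close>, with
        \<open>t = \<bar>w x\<bar> + \<epsilon> \<ge> w x\<close>, the integrand is at most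
        \<open>t powr (- (b * p)) * t = t powr (- b)\<close>, which is
        \<open>\<sigma> \<epsilon> x\<close>.\<close>
      have fp: "(\<integral>\<^sup>+x. ennreal (\<bar>f x\<bar> powr p) * ennreal (w x) \<partial>lebesgue) \<le> m \<epsilon> * ennreal c"
        unfolding I[symmetric]
      proof (rule nn_integral_mono)
        fix x
        show "ennreal (\<bar>f x\<bar> powr p) * ennreal (w x) \<le> ennreal (\<sigma> \<epsilon> x) * indicator Q x"
        proof (cases "x \<in> Q")
          case True
          define t where "t = \<bar>w x\<bar> + \<epsilon>"
          have t: "0 < t" "w x \<le> t" using \<epsilon> by (auto simp: t_def)
          have "ennreal (\<bar>f x\<bar> powr p) * ennreal (w x) \<le> ennreal ((t powr (- b)) powr p) * ennreal t"
            using t True by (intro mult_mono ennreal_leI) (auto simp: f_def \<sigma>_def t_def)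
          also have "\<dots> = ennreal (t powr (- (b * p)) * t powr 1)"
            using t by (simp add: powr_powr ennreal_mult[symmetric])
          also have "t powr (- (b * p)) * t powr 1 = t powr (- b)"
            unfolding powr_add[symmetric] b(3) by simp
          finally show ?thesis using True by (simp add: \<sigma>_def t_def)
        qed (use p in \<open>simp add: f_def\<close>)
      qed
      then have "f \<in> weighted_Lp p w"
        using le_less_trans[OF fp fin] by (simp add: weighted_Lp_def)
      have "average Q (\<lambda>y. ennreal \<bar>f y\<bar>) = m \<epsilon>"
        unfolding average_def m_def
        by (intro arg_cong2[of _ _ _ _ "(/)"] nn_integral_cong) (auto simp: f_def indicator_def \<sigma>_def)
      then have Mf: "m \<epsilon> \<le> maximal_function f y" if "y \<in> Q" for y
        unfolding maximal_function_def using that Q by (intro SUP_upper2[of Q]) auto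
      \<comment> \<open>Move the integral of \<open>w \<circ> A\<close> over \<open>Q\<close> to one
        of \<open>w\<close> over the image of \<open>Q\<close> under \<open>A\<close>, where the
        twisted maximal function of \<open>f\<close> is at least
        \<open>m \<epsilon>\<close>.\<close>
      have "(\<integral>\<^sup>+x\<in>Q. ennreal (w (A *v x)) \<partial>lebesgue)
          = (\<integral>\<^sup>+x. (\<lambda>y. indicator Q (matrix_inv A *v y) * ennreal (w y)) (A *v x) \<partial>lebesgue)"
        by (simp add: invertible_matrix_cancel[OF A] mult.commute)
      also have "\<dots> \<le> d * (\<integral>\<^sup>+y. indicator Q (matrix_inv A *v y) * ennreal (w y) \<partial>lebesgue)"
        by (rule d(2)) measurable
      finally have "epowr (m \<epsilon>) p * (\<integral>\<^sup>+x\<in>Q. ennreal (w (A *v x)) \<partial>lebesgue)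
          \<le> epowr (m \<epsilon>) p * (d * (\<integral>\<^sup>+y. indicator Q (matrix_inv A *v y) * ennreal (w y) \<partial>lebesgue))"
        by (rule mult_left_mono) simp
      also have "\<dots> = d * (\<integral>\<^sup>+y. epowr (m \<epsilon>) p * (indicator Q (matrix_inv A *v y) * ennreal (w y)) \<partial>lebesgue)"
        by (subst nn_integral_cmult) (auto simp: mult_ac)
      also have "\<dots> \<le> d * (\<integral>\<^sup>+x. epowr (maximal_function_inv A f x) p * ennreal (w x) \<partial>lebesgue)"
      proof (intro mult_left_mono nn_integral_mono)
        fix y
        show "epowr (m \<epsilon>) p * (indicator Q (matrix_inv A *v y) * ennreal (w y))
            \<le> epowr (maximal_function_inv A f y) p * ennreal (w y)"
          using p Mf by (cases "matrix_inv A *v y \<in> Q")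
            (auto simp: maximal_function_inv_def intro!: mult_right_mono epowr_mono)
      qed simp
      also have "\<dots> \<le> d * (ennreal C * (m \<epsilon> * ennreal c))"
        by (intro mult_left_mono order_trans[OF bound mult_left_mono] fp \<open>f \<in> weighted_Lp p w\<close>) auto
      finally have *: "epowr (m \<epsilon>) p * (\<integral>\<^sup>+x\<in>Q. ennreal (w (A *v x)) \<partial>lebesgue) \<le> D * (m \<epsilon> * ennreal c)"
        by (simp add: D_def mult_ac)
      have "(\<integral>\<^sup>+x\<in>Q. ennreal (w (A *v x)) \<partial>lebesgue) = V * ennreal c"
        using c(2) by (simp add: V_def average mult.assoc ennreal_mult[symmetric])
      moreover have "epowr (m \<epsilon>) p = epowr (m \<epsilon>) (p - 1) * m \<epsilon>"
        using epowr_add[of "m \<epsilon>" "p - 1" 1] by simp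
      ultimately have "(m \<epsilon> * ennreal c) * (V * epowr (m \<epsilon>) (p - 1)) \<le> (m \<epsilon> * ennreal c) * D"
        using * by (simp add: mult_ac)
      moreover have "m \<epsilon> * ennreal c \<noteq> 0" using m0 c(2) by auto
      ultimately show ?thesis using fin m0
        by (subst (asm) ennreal_mult_le_mult_iff) auto
    qed
    \<comment> \<open>The bound for a single \<open>\<epsilon>\<close> already yields this, since
      \<open>m 1\<close> is positive.\<close>
    have V_fin: "V < \<infinity>"
    proof -
      have "V * epowr (m 1) (p - 1) < \<infinity>" using eps[of 1] D by (meson le_less_trans zero_less_one)
      moreover have "0 < epowr (m 1) (p - 1)"
        using eps[of 1] by (cases "m 1") auto
      ultimately show ?thesis by (auto simp: ennreal_mult_less_top)
    qed
    \<comment> \<open>A bound for \<open>m \<epsilon>\<close> that is uniform in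
      \<open>\<epsilon>\<close>, obtained by solving the inequality in \<open>eps\<close>.\<close>
    define B where "B = epowr (D / V) (1 / (p - 1))"
    have m_le: "m \<epsilon> \<le> B" if "0 < \<epsilon>" for \<epsilon>
    proof -
      have "epowr (m \<epsilon>) (p - 1) \<le> D / V"
        using eps[OF that] V0 V_fin
        by (metis divide_right_mono_ennreal ennreal_mult_divide_eq infinity_ennreal_def less_irrefl mult.commute)
      then show ?thesis using p by (simp add: B_def epowr_le_iff)
    qed
    have "average Q (\<lambda>x. ennreal (w x powr (- b))) \<le> B"
    proof -
      \<comment> \<open>The exponent \<open>- b\<close> is negative, so the functions increase as
        \<open>\<epsilon>\<close> decreases and monotone convergence carries the uniform bound to
        the dual weight itself.\<close>
      define g where "g n x = ennreal (\<sigma> (inverse (real (Suc n))) x) * indicator Q x" for n x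
      have g_meas [measurable]: "g n \<in> borel_measurable lebesgue" for n
        unfolding g_def by measurable
      have inc: "incseq g"
      proof (intro incseq_SucI le_funI)
        fix n x
        have "\<sigma> (inverse (real (Suc n))) x \<le> \<sigma> (inverse (real (Suc (Suc n)))) x"
          unfolding \<sigma>_def using b(1) by (intro powr_mono2') (auto simp: add_nonneg_pos)
        then show "g n x \<le> g (Suc n) x"
          unfolding g_def by (intro mult_right_mono ennreal_leI) auto
      qed
      have "(\<integral>\<^sup>+x\<in>Q. ennreal (w x powr (- b)) \<partial>lebesgue) = (\<integral>\<^sup>+x. (SUP n. g n x) \<partial>lebesgue)"
      proof (rule nn_integral_cong_AE)
        show "AE x in lebesgue. ennreal (w x powr (- b)) * indicator Q x = (SUP n. g n x)"
          using pos
        proof eventually_elim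
          case (elim x)
          have "(\<lambda>n. (w x + inverse (real (Suc n))) powr (- b)) \<longlonglongrightarrow> (w x + 0) powr (- b)"
            using elim by (intro tendsto_intros LIMSEQ_inverse_real_of_nat) auto
          then have "(\<lambda>n. \<sigma> (inverse (real (Suc n))) x) \<longlonglongrightarrow> w x powr (- b)"
            using elim by (simp add: \<sigma>_def)
          then have "(\<lambda>n. g n x) \<longlonglongrightarrow> ennreal (w x powr (- b)) * indicator Q x"
            unfolding g_def by (cases "x \<in> Q") (auto intro!: tendsto_ennrealI)
          moreover have "(\<lambda>n. g n x) \<longlonglongrightarrow> (SUP n. g n x)"
            using inc by (intro LIMSEQ_SUP) (auto simp: incseq_def le_fun_def)
          ultimately show ?case by (rule LIMSEQ_unique)
        qed
      qed
      also have "\<dots> = (SUP n. \<integral>\<^sup>+x. g n x \<partial>lebesgue)"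
        by (rule nn_integral_monotone_convergence_SUP[OF inc g_meas])
      finally have "average Q (\<lambda>x. ennreal (w x powr (- b))) = (SUP n. (\<integral>\<^sup>+x. g n x \<partial>lebesgue) * ennreal (inverse c))"
        by (simp add: average SUP_mult_right_ennreal)
      also have "\<dots> \<le> B"
      proof (rule SUP_least)
        fix n
        show "(\<integral>\<^sup>+x. g n x \<partial>lebesgue) * ennreal (inverse c) \<le> B"
          using m_le[of "inverse (real (Suc n))"] by (simp add: m_def average g_def)
      qed
      finally show ?thesis .
    qed
    then have "epowr (average Q (\<lambda>x. ennreal (w x powr (- b)))) (p - 1) \<le> D / V"
      using p by (simp add: B_def epowr_le_iff)
    then have "V * epowr (average Q (\<lambda>x. ennreal (w x powr (- b)))) (p - 1) \<le> V * (D / V)"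
      by (rule mult_left_mono) simp
    also have "\<dots> = D" using V0 V_fin by (rule ennreal_mult_divide_cancel)
    finally show ?thesis unfolding V_def b(2) .
  qed
  have "A_constant A p w \<le> D"
    unfolding A_constant_def by (intro SUP_least cube_bound)
  then show ?thesis using D by (rule le_less_trans)
qed

theorem corollary1p5:
  fixes A :: "real ^ 'n ^ 'n" and w :: "real ^ 'n \<Rightarrow> real" and p :: real
  assumes "1 < p"
    and "invertible A"
    and "\<exists>k. 0 < k \<and> matrix_pow A k = mat 1"
    and "weight w"
  shows "w \<in> A_class A p \<longleftrightarrow>
    (\<exists>C::real. \<forall>f \<in> weighted_Lp p w.
       (\<integral>\<^sup>+x. epowr (maximal_function_inv A f x) p * ennreal (w x) \<partial>lebesgue)
         \<le> ennreal C * (\<integral>\<^sup>+x. ennreal (\<bar>f x\<bar> powr p) * ennreal (w x) \<partial>lebesgue))"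
proof
  assume "w \<in> A_class A p"
  then have K: "A_constant A p w < \<infinity>" by (simp add: A_class_def)
  obtain k where "0 < k" "matrix_pow A k = mat 1" using assms(3) by blast
  from maximal_bound_of_A_class[OF assms(1,2) this assms(4) K]
  show "\<exists>C::real. \<forall>f \<in> weighted_Lp p w.
       (\<integral>\<^sup>+x. epowr (maximal_function_inv A f x) p * ennreal (w x) \<partial>lebesgue)
         \<le> ennreal C * (\<integral>\<^sup>+x. ennreal (\<bar>f x\<bar> powr p) * ennreal (w x) \<partial>lebesgue)"
    by (auto simp: weighted_Lp_def)
next
  assume "\<exists>C::real. \<forall>f \<in> weighted_Lp p w.
       (\<integral>\<^sup>+x. epowr (maximal_function_inv A f x) p * ennreal (w x) \<partial>lebesgue)
         \<le> ennreal C * (\<integral>\<^sup>+x. ennreal (\<bar>f x\<bar> powr p) * ennreal (w x) \<partial>lebesgue)"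
  then have "A_constant A p w < \<infinity>"
    using A_constant_finite_of_maximal_bound[OF assms(1,2,4)] by blast
  then show "w \<in> A_class A p" using assms(4) by (simp add: A_class_def)
qed

end
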